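(* Let $\mathcal Q$ be a complete subset of $\mathcal P_{\mathrm{gen}}$, and let $\rho:\mathcal Q\to\mathbf G$ be a $\mathcal Q$-germ. Then: - There is a unique germ $\widehat\rho:\mathcal P_{\mathrm{gen}}\to\mathbf G$ (i.e. a $\mathcal P_{\mathrm{gen}}$-germ) extending $\rho$. - The map $\widehat\rho$ is given by $\widehat\rho(\gamma)=\prod_{i=1}^I\rho(\gamma_i)$ (ordered product) for each $\gamma\in\mathcal P_{\mathrm{gen}}$, where $\gamma_1\cdots\gamma_I$ is any decomposition of $\gamma$ into paths in $\mathcal Q$. - The map $\widehat\rho$ is constant on equivalence classes in $\mathcal P_{\mathrm{gen}}$. - The induced map $[\widehat\rho]:\mathcal P\to\mathbf G$ is a homomorphism.
   Context: Fix a manifold $M$, a connected Lie group $\mathbf G$, and $r$ a positive integer, $\infty$ or $\omega$. Fix also the choice whether all paths are required to be piecewise embedded or not. A path is a piecewise $C^r$ map $[0,1]\to M$ (piecewise embedded, if so chosen). A path is trivial iff its image is a single point. The inverse is $\gamma^{-1}(t):=\gamma(1-t)$. Paths $\gamma_1,\gamma_2$ are composable iff $\gamma_1(1)=\gamma_2(0)$; then $(\gamma_1\gamma_2)(t):=\gamma_1(2t)$ for $t\in[0,\frac12]$ and $\gamma_2(2t-1)$ for $t\in[\frac12,1]$. An edge is a path $e$ such that $e(t_1)=e(t_2)$ implies $|t_1-t_2|\in\{0,1\}$. Two paths $\gamma_1,\gamma_2$ coincide up to the parametrization iff $\gamma_1=\gamma_2\circ\phi$ for some orientation preserving piecewise $C^r$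 diffeomorphism $\phi:[0,1]\to[0,1]$. A path is finite iff it equals, up to the parametrization, a finite product of edges and trivial paths; all paths are assumed finite. Two paths are equivalent iff there is a finite sequence of paths from one to the other in which any two subsequent paths coincide up to the parametrization or up to insertion or deletion of a retracing $\delta\delta^{-1}$ (e.g. $\gamma_1\gamma_2$ and $\gamma_1\delta\delta^{-1}\gamma_2$). $\mathcal P_{\mathrm{gen}}$ is the set of all paths, $\mathcal P$ the set of equivalence classes $[\gamma]$; $\mathcal P$ is a groupoid. A decomposition of a path $\gamma$ is a finite sequence $(\gamma_1,\dots,\gamma_n)$ of paths, also written $\gamma_1\cdots\gamma_n$, whose product equals $\gamma$ up to the parametrization. A subset $\mathcal Q\subseteq\mathcal P_{\mathrm{gen}}$ is hereditary iff for each $\gamma\in\mathcal Q$ one has $\gamma^{-1}\in\mathcal Q$ and every decomposition of $\gamma$ consists of paths in $\mathcal Q$. It is complete iff it is hereditary and every path in $\mathcal P_{\mathrm{gen}}$ has a decomposition into paths in $\mathcal Q$. For $\mathcal Q$ hereditary, a map $\rho:\mathcal Q\to\mathbf G$ is a $\mathcal Q$-germ (or germ) iff for all $\gamma\in\mathcal Q$: $\rho(\gamma^{-1})=\rho(\gamma)^{-1}$, and $\rho(\gamma)=\rho(\gamma_1)\rho(\gamma_2)$ for all decompositions $\gamma_1\gamma_2$ of $\gamma$. *)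

theory Defs
  imports "HOL-Analysis.Analysis" "HOL-Algebra.Group"
begin

section \<open>Differentiability classes\<close>

datatype regularity = C_fin nat | C_inf | C_omega

primrec Ck_on :: "nat \<Rightarrow> 'a::real_normed_vector set \<Rightarrow> ('a \<Rightarrow> 'b::real_normed_vector) \<Rightarrow> bool" where
  "Ck_on 0 U f \<longleftrightarrow> continuous_on U f"
| "Ck_on (Suc k) U f \<longleftrightarrow>
     (\<exists>f'. (\<forall>x\<in>U. (f has_derivative f' x) (at x)) \<and> (\<forall>v. Ck_on k U (\<lambda>x. f' x v)))"

text \<open>
  The \<open>n\<close>-th derivative at \<open>0\<close> of \<open>t \<mapsto> f (x + t h)\<close>, that is \<open>D\<^sup>n f x (h, \<dots>, h)\<close>.
\<close>

definition dir_deriv ::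
  "nat \<Rightarrow> ('a::real_normed_vector \<Rightarrow> 'b::real_normed_vector) \<Rightarrow> 'a \<Rightarrow> 'a \<Rightarrow> 'b" where
  "dir_deriv n f x h =
     ((\<lambda>g t. vector_derivative g (at t)) ^^ n) (\<lambda>t::real. f (x + t *\<^sub>R h)) 0"

definition analytic_at_pt ::
  "('a::real_normed_vector \<Rightarrow> 'b::real_normed_vector) \<Rightarrow> 'a \<Rightarrow> bool" where
  "analytic_at_pt f x \<longleftrightarrow>
     (\<exists>\<epsilon>>0. \<forall>h. norm h < \<epsilon> \<longrightarrow> (\<lambda>n. dir_deriv n f x h /\<^sub>R fact n) sums f (x + h))"

text \<open>
  \<open>Cr_on r U f\<close> is meant for open \<open>U\<close> in a finite-dimensional space.  Real analytic functions are
  the smooth functions that agree with their Taylor series near each point.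
\<close>

fun Cr_on :: "regularity \<Rightarrow> 'a::real_normed_vector set \<Rightarrow> ('a \<Rightarrow> 'b::real_normed_vector) \<Rightarrow> bool" where
  "Cr_on (C_fin k) U f \<longleftrightarrow> Ck_on k U f"
| "Cr_on C_inf U f \<longleftrightarrow> (\<forall>k. Ck_on k U f)"
| "Cr_on C_omega U f \<longleftrightarrow> (\<forall>k. Ck_on k U f) \<and> (\<forall>x\<in>U. analytic_at_pt f x)"

section \<open>Manifolds and Lie groups\<close>

type_synonym ('m, 'e) chart = "'m set \<times> ('m \<Rightarrow> 'e)"

text \<open>
  The model space is a finite-dimensional normed space rather than a type of class
  \<open>euclidean_space\<close>, because the latter would rule out dimension \<open>0\<close>.  An atlas need not be maximal.
\<close>

definition manifold ::
  "regularity \<Rightarrow> 'm topology \<Rightarrow> ('m, 'e::real_normed_vector) chart set \<Rightarrow> bool" where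
  "manifold r X A \<longleftrightarrow>
     Hausdorff_space X \<and> second_countable X \<and>
     (\<exists>B::'e set. finite B \<and> span B = UNIV) \<and>
     (\<forall>(U, \<phi>)\<in>A. openin X U \<and> open (\<phi> ` U) \<and>
        homeomorphic_map (subtopology X U) (top_of_set (\<phi> ` U)) \<phi>) \<and>
     (\<Union>(U, \<phi>)\<in>A. U) = topspace X \<and>
     (\<forall>(U, \<phi>)\<in>A. \<forall>(V, \<psi>)\<in>A. Cr_on r (\<phi> ` (U \<inter> V)) (\<psi> \<circ> inv_into U \<phi>))"

definition Cr_map ::
  "regularity \<Rightarrow> 'm topology \<Rightarrow> ('m, 'e::real_normed_vector) chart set \<Rightarrow>
   'n topology \<Rightarrow> ('n, 'f::real_normed_vector) chart set \<Rightarrow> ('m \<Rightarrow> 'n) \<Rightarrow> bool" where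
  "Cr_map r X A Y B f \<longleftrightarrow> continuous_map X Y f \<and>
     (\<forall>(U, \<phi>)\<in>A. \<forall>(V, \<psi>)\<in>B. Cr_on r (\<phi> ` (U \<inter> f -` V)) (\<psi> \<circ> f \<circ> inv_into U \<phi>))"

definition prod_atlas ::
  "('m, 'e) chart set \<Rightarrow> ('n, 'f) chart set \<Rightarrow> ('m \<times> 'n, 'e \<times> 'f) chart set" where
  "prod_atlas A B = {(U \<times> V, map_prod \<phi> \<psi>) | U \<phi> V \<psi>. (U, \<phi>) \<in> A \<and> (V, \<psi>) \<in> B}"

definition lie_group ::
  "('g, 'z) monoid_scheme \<Rightarrow> 'g topology \<Rightarrow> ('g, 'f::real_normed_vector) chart set \<Rightarrow> bool" where
  "lie_group G T B \<longleftrightarrow>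
     group G \<and> topspace T = carrier G \<and> manifold C_inf T B \<and>
     Cr_map C_inf (prod_topology T T) (prod_atlas B B) T B (\<lambda>(x, y). x \<otimes>\<^bsub>G\<^esub> y) \<and>
     Cr_map C_inf T B T B (\<lambda>x. inv\<^bsub>G\<^esub> x)"

section \<open>Piecewise \<open>C\<^sup>r\<close> curves\<close>

text \<open>
  \<open>g\<close> represents \<open>\<gamma>\<close> near \<open>t\<close> in some chart.  It is \<open>C\<^sup>r\<close> on a full neighbourhood of \<open>t\<close> in the
  real line and agrees with \<open>\<gamma>\<close> only on the part inside \<open>J\<close>; at the end points of an interval \<open>J\<close>
  this is the usual notion of being \<open>C\<^sup>r\<close> on a set that is not open.
\<close>

definition curve_rep ::
  "regularity \<Rightarrow> ('m, 'e::real_normed_vector) chart set \<Rightarrow> real set \<Rightarrow> (real \<Rightarrow> 'm) \<Rightarrow>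
   real \<Rightarrow> (real \<Rightarrow> 'e) \<Rightarrow> bool" where
  "curve_rep r A J \<gamma> t g \<longleftrightarrow>
     (\<exists>(U, \<phi>)\<in>A. \<exists>W. open W \<and> t \<in> W \<and> Cr_on r W g \<and> (\<forall>s\<in>W \<inter> J. \<gamma> s \<in> U \<and> \<phi> (\<gamma> s) = g s))"

definition Cr_curve ::
  "regularity \<Rightarrow> ('m, 'e::real_normed_vector) chart set \<Rightarrow> real set \<Rightarrow> (real \<Rightarrow> 'm) \<Rightarrow> bool" where
  "Cr_curve r A J \<gamma> \<longleftrightarrow> (\<forall>t\<in>J. \<exists>g. curve_rep r A J \<gamma> t g)"

definition Cr_embedding ::
  "regularity \<Rightarrow> 'm topology \<Rightarrow> ('m, 'e::real_normed_vector) chart set \<Rightarrow> real set \<Rightarrow>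
   (real \<Rightarrow> 'm) \<Rightarrow> bool" where
  "Cr_embedding r X A J \<gamma> \<longleftrightarrow> embedding_map (top_of_set J) X \<gamma> \<and>
     (\<forall>t\<in>J. \<exists>g. curve_rep r A J \<gamma> t g \<and> vector_derivative g (at t) \<noteq> 0)"

definition piecewise :: "(real set \<Rightarrow> (real \<Rightarrow> 'm) \<Rightarrow> bool) \<Rightarrow> (real \<Rightarrow> 'm) \<Rightarrow> bool" where
  "piecewise P \<gamma> \<longleftrightarrow> (\<exists>(n::nat) t. t 0 = 0 \<and> t n = 1 \<and>
     (\<forall>i<n. t i < t (Suc i) \<and> P {t i..t (Suc i)} \<gamma>))"

section \<open>Paths\<close>

text \<open>
  The choice which pieces a path may consist of.  A constant path is not piecewise embedded in the
  strict sense of \<open>Embedded\<close>; the convention that admits trivial paths (and products with them)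
  next to piecewise embedded ones is \<open>Embedded_or_const\<close>.
\<close>

datatype path_kind = Arbitrary | Embedded | Embedded_or_const

fun piece ::
  "regularity \<Rightarrow> path_kind \<Rightarrow> 'm topology \<Rightarrow> ('m, 'e::real_normed_vector) chart set \<Rightarrow> real set \<Rightarrow>
   (real \<Rightarrow> 'm) \<Rightarrow> bool" where
  "piece r Arbitrary X A J \<gamma> \<longleftrightarrow> Cr_curve r A J \<gamma>"
| "piece r Embedded X A J \<gamma> \<longleftrightarrow> Cr_embedding r X A J \<gamma>"
| "piece r Embedded_or_const X A J \<gamma> \<longleftrightarrow> Cr_embedding r X A J \<gamma> \<or> (\<exists>p. \<forall>t\<in>J. \<gamma> t = p)"

text \<open>
  A map on \<open>[0,1]\<close> is a function of type \<open>real \<Rightarrow> 'm\<close> that is \<open>undefined\<close> outside \<open>[0,1]\<close>, so that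
  equality of functions is equality of maps on \<open>[0,1]\<close>.  The prepaths are the paths before the
  finiteness requirement.
\<close>

definition prepaths ::
  "regularity \<Rightarrow> path_kind \<Rightarrow> 'm topology \<Rightarrow> ('m, 'e::real_normed_vector) chart set \<Rightarrow>
   (real \<Rightarrow> 'm) set" where
  "prepaths r k X A = {\<gamma> \<in> {0..1} \<rightarrow>\<^sub>E topspace X. piecewise (piece r k X A) \<gamma>}"

definition trivial_path :: "(real \<Rightarrow> 'm) \<Rightarrow> bool" where
  "trivial_path \<gamma> \<longleftrightarrow> (\<exists>p. \<gamma> ` {0..1} = {p})"

definition is_edge :: "(real \<Rightarrow> 'm) \<Rightarrow> bool" where
  "is_edge e \<longleftrightarrow> (\<forall>t1\<in>{0..1}. \<forall>t2\<in>{0..1}. e t1 = e t2 \<longrightarrow> \<bar>t1 - t2\<bar> \<in> {0, 1})"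

definition path_inv :: "(real \<Rightarrow> 'm) \<Rightarrow> real \<Rightarrow> 'm" where
  "path_inv \<gamma> = (\<lambda>t\<in>{0..1}. \<gamma> (1 - t))"

definition composable :: "(real \<Rightarrow> 'm) \<Rightarrow> (real \<Rightarrow> 'm) \<Rightarrow> bool" where
  "composable \<gamma>1 \<gamma>2 \<longleftrightarrow> \<gamma>1 1 = \<gamma>2 0"

definition path_mult :: "(real \<Rightarrow> 'm) \<Rightarrow> (real \<Rightarrow> 'm) \<Rightarrow> real \<Rightarrow> 'm" where
  "path_mult \<gamma>1 \<gamma>2 = (\<lambda>t\<in>{0..1}. if t \<le> 1/2 then \<gamma>1 (2 * t) else \<gamma>2 (2 * t - 1))"

text \<open>
  Products of more than two paths are bracketed to the right; other bracketings only change the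
  parametrization.
\<close>

fun path_prod :: "(real \<Rightarrow> 'm) list \<Rightarrow> real \<Rightarrow> 'm" where
  "path_prod [] = undefined"
| "path_prod [\<gamma>] = \<gamma>"
| "path_prod (\<gamma> # \<gamma>' # \<gamma>s) = path_mult \<gamma> (path_prod (\<gamma>' # \<gamma>s))"

definition reparametrization :: "regularity \<Rightarrow> (real \<Rightarrow> real) \<Rightarrow> bool" where
  "reparametrization r \<phi> \<longleftrightarrow>
     bij_betw \<phi> {0..1} {0..1} \<and> strict_mono_on {0..1} \<phi> \<and>
     piecewise (Cr_curve r {(UNIV, id)}) \<phi> \<and>
     piecewise (Cr_curve r {(UNIV, id)}) (inv_into {0..1} \<phi>)"

definition coincide :: "regularity \<Rightarrow> (real \<Rightarrow> 'm) \<Rightarrow> (real \<Rightarrow> 'm) \<Rightarrow> bool" where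
  "coincide r \<gamma>1 \<gamma>2 \<longleftrightarrow> (\<exists>\<phi>. reparametrization r \<phi> \<and> (\<forall>t\<in>{0..1}. \<gamma>1 t = \<gamma>2 (\<phi> t)))"

definition paths ::
  "regularity \<Rightarrow> path_kind \<Rightarrow> 'm topology \<Rightarrow> ('m, 'e::real_normed_vector) chart set \<Rightarrow>
   (real \<Rightarrow> 'm) set" where
  "paths r k X A = {\<gamma> \<in> prepaths r k X A.
     \<exists>es. es \<noteq> [] \<and> set es \<subseteq> prepaths r k X A \<and> (\<forall>e\<in>set es. is_edge e \<or> trivial_path e) \<and>
       successively composable es \<and> coincide r \<gamma> (path_prod es)}"

section \<open>The path groupoid\<close>

text \<open>
  Retracings may be inserted between two factors as well as at the beginning (\<open>as = []\<close>) and at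
  the end (\<open>bs = []\<close>).
\<close>

definition insert_retracing ::
  "(real \<Rightarrow> 'm) set \<Rightarrow> (real \<Rightarrow> 'm) \<Rightarrow> (real \<Rightarrow> 'm) \<Rightarrow> bool" where
  "insert_retracing P \<gamma> \<gamma>' \<longleftrightarrow>
     (\<exists>as \<delta> bs. as @ bs \<noteq> [] \<and> set (as @ \<delta> # bs) \<subseteq> P \<and>
        successively composable (as @ bs) \<and>
        successively composable (as @ [\<delta>, path_inv \<delta>] @ bs) \<and>
        \<gamma> = path_prod (as @ bs) \<and> \<gamma>' = path_prod (as @ [\<delta>, path_inv \<delta>] @ bs))"

definition elementary_step ::
  "regularity \<Rightarrow> (real \<Rightarrow> 'm) set \<Rightarrow> (real \<Rightarrow> 'm) \<Rightarrow> (real \<Rightarrow> 'm) \<Rightarrow> bool" where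
  "elementary_step r P \<gamma> \<gamma>' \<longleftrightarrow>
     \<gamma> \<in> P \<and> \<gamma>' \<in> P \<and> (coincide r \<gamma> \<gamma>' \<or> insert_retracing P \<gamma> \<gamma>')"

definition path_equiv ::
  "regularity \<Rightarrow> path_kind \<Rightarrow> 'm topology \<Rightarrow> ('m, 'e::real_normed_vector) chart set \<Rightarrow>
   (real \<Rightarrow> 'm) rel" where
  "path_equiv r k X A =
     {(\<gamma>, \<gamma>'). \<gamma> \<in> paths r k X A \<and> \<gamma>' \<in> paths r k X A \<and>
        equivclp (elementary_step r (paths r k X A)) \<gamma> \<gamma>'}"

definition path_classes ::
  "regularity \<Rightarrow> path_kind \<Rightarrow> 'm topology \<Rightarrow> ('m, 'e::real_normed_vector) chart set \<Rightarrow>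
   (real \<Rightarrow> 'm) set set" where
  "path_classes r k X A = paths r k X A // path_equiv r k X A"

definition class_composable :: "(real \<Rightarrow> 'm) set \<Rightarrow> (real \<Rightarrow> 'm) set \<Rightarrow> bool" where
  "class_composable C D \<longleftrightarrow> (\<exists>\<gamma>1\<in>C. \<exists>\<gamma>2\<in>D. composable \<gamma>1 \<gamma>2)"

text \<open>
  The product \<open>[\<gamma>1] [\<gamma>2] = [\<gamma>1 \<gamma>2]\<close>, as the union over all representatives (which all
  yield the same class).
\<close>

definition class_mult ::
  "regularity \<Rightarrow> path_kind \<Rightarrow> 'm topology \<Rightarrow> ('m, 'e::real_normed_vector) chart set \<Rightarrow>
   (real \<Rightarrow> 'm) set \<Rightarrow> (real \<Rightarrow> 'm) set \<Rightarrow> (real \<Rightarrow> 'm) set" where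
  "class_mult r k X A C D = (\<Union>\<gamma>1\<in>C. \<Union>\<gamma>2\<in>D. path_equiv r k X A `` {path_mult \<gamma>1 \<gamma>2})"

definition groupoid_hom ::
  "regularity \<Rightarrow> path_kind \<Rightarrow> 'm topology \<Rightarrow> ('m, 'e::real_normed_vector) chart set \<Rightarrow>
   ('g, 'z) monoid_scheme \<Rightarrow> ((real \<Rightarrow> 'm) set \<Rightarrow> 'g) \<Rightarrow> bool" where
  "groupoid_hom r k X A G h \<longleftrightarrow> h \<in> path_classes r k X A \<rightarrow> carrier G \<and>
     (\<forall>C\<in>path_classes r k X A. \<forall>D\<in>path_classes r k X A. class_composable C D \<longrightarrow>
        h (class_mult r k X A C D) = h C \<otimes>\<^bsub>G\<^esub> h D)"

text \<open>
  The value of \<open>\<rho>\<close> on a class; meaningful for \<open>\<rho>\<close> constant on that class.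
\<close>

definition induced_map :: "((real \<Rightarrow> 'm) \<Rightarrow> 'g) \<Rightarrow> (real \<Rightarrow> 'm) set \<Rightarrow> 'g" where
  "induced_map \<rho> C = the_elem (\<rho> ` C)"

section \<open>Decompositions and germs\<close>

definition decomposition ::
  "regularity \<Rightarrow> path_kind \<Rightarrow> 'm topology \<Rightarrow> ('m, 'e::real_normed_vector) chart set \<Rightarrow>
   (real \<Rightarrow> 'm) list \<Rightarrow> (real \<Rightarrow> 'm) \<Rightarrow> bool" where
  "decomposition r k X A \<gamma>s \<gamma> \<longleftrightarrow>
     \<gamma>s \<noteq> [] \<and> set \<gamma>s \<subseteq> paths r k X A \<and> successively composable \<gamma>s \<and>
     coincide r (path_prod \<gamma>s) \<gamma>"

definition hereditary ::
  "regularity \<Rightarrow> path_kind \<Rightarrow> 'm topology \<Rightarrow> ('m, 'e::real_normed_vector) chart set \<Rightarrow>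
   (real \<Rightarrow> 'm) set \<Rightarrow> bool" where
  "hereditary r k X A Q \<longleftrightarrow> Q \<subseteq> paths r k X A \<and>
     (\<forall>\<gamma>\<in>Q. path_inv \<gamma> \<in> Q \<and> (\<forall>\<gamma>s. decomposition r k X A \<gamma>s \<gamma> \<longrightarrow> set \<gamma>s \<subseteq> Q))"

definition complete_paths ::
  "regularity \<Rightarrow> path_kind \<Rightarrow> 'm topology \<Rightarrow> ('m, 'e::real_normed_vector) chart set \<Rightarrow>
   (real \<Rightarrow> 'm) set \<Rightarrow> bool" where
  "complete_paths r k X A Q \<longleftrightarrow> hereditary r k X A Q \<and>
     (\<forall>\<gamma>\<in>paths r k X A. \<exists>\<gamma>s. decomposition r k X A \<gamma>s \<gamma> \<and> set \<gamma>s \<subseteq> Q)"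

definition germ ::
  "regularity \<Rightarrow> path_kind \<Rightarrow> 'm topology \<Rightarrow> ('m, 'e::real_normed_vector) chart set \<Rightarrow>
   ('g, 'z) monoid_scheme \<Rightarrow> (real \<Rightarrow> 'm) set \<Rightarrow> ((real \<Rightarrow> 'm) \<Rightarrow> 'g) \<Rightarrow> bool" where
  "germ r k X A G Q \<rho> \<longleftrightarrow> hereditary r k X A Q \<and> \<rho> \<in> Q \<rightarrow> carrier G \<and>
     (\<forall>\<gamma>\<in>Q. \<rho> (path_inv \<gamma>) = inv\<^bsub>G\<^esub> (\<rho> \<gamma>) \<and>
        (\<forall>\<gamma>1 \<gamma>2. decomposition r k X A [\<gamma>1, \<gamma>2] \<gamma> \<longrightarrow> \<rho> \<gamma> = \<rho> \<gamma>1 \<otimes>\<^bsub>G\<^esub> \<rho> \<gamma>2))"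

end

theory Submission
  imports Defs
begin

text \<open>
  A path restricted to the intervals of a partition decomposes into segments, and every decomposition
  arises in this way up to the parametrization.  By completeness some partition of \<open>\<gamma>\<close> has all its
  segments in \<open>Q\<close>, and \<open>\<rho>\<close> extended to \<open>\<gamma>\<close> must be the ordered product of the values on these
  segments.  Since \<open>\<rho>\<close> is a germ, the product does not change when a partition is refined, so any two
  partitions give the same value, as they have a common refinement.  All parametrizations that have
  to be constructed are obtained from given ones by gluing and by affine changes of coordinates;
  general compositions of \<open>C\<^sup>r\<close> maps never occur.
\<close>

section \<open>Piecewise properties on intervals\<close>

text \<open>Two obstacles shape the development. Composing piecewise C^r maps would call for higher
  chain rules and composition of power series, so transitivity of \<open>coincide\<close> is
  avoided. A reparametrization is kept as one map with an explicit inverse, is cut along a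
  partition, and is moved to other intervals by affine maps. Since a path is exactly the product of
  its two halves, germs turn out to be invariant under reparametrization without transitivity. The
  second obstacle is that a segment of a path must again be a path, although finiteness is defined
  through products and reparametrizations. \<open>paths_iff\<close> turns finiteness into a
  condition on the intervals of a partition: the path is injective or constant on each. Smoothness
  and embeddedness of a path are never carried along a reparametrization; membership in
  \<open>\<P>\<close> is established independently.\<close>

inductive piecewise_on ::
  "(real set \<Rightarrow> (real \<Rightarrow> 'a) \<Rightarrow> bool) \<Rightarrow> (real \<Rightarrow> 'a) \<Rightarrow> real \<Rightarrow> real \<Rightarrow> bool"
  for P f where
  single: "a < b \<Longrightarrow> P {a..b} f \<Longrightarrow> piecewise_on P f a b"
| step: "a < b \<Longrightarrow> P {a..b} f \<Longrightarrow> piecewise_on P f b c \<Longrightarrow> piecewise_on P f a c"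

lemma piecewise_on_less: "piecewise_on P f a b \<Longrightarrow> a < b"
  by (induction rule: piecewise_on.induct) auto

lemma piecewise_on_trans:
  "piecewise_on P f a b \<Longrightarrow> piecewise_on P f b c \<Longrightarrow> piecewise_on P f a c"
  by (induction rule: piecewise_on.induct) (auto intro: piecewise_on.intros)

lemma piecewise_onD_partition:
  assumes "piecewise_on P f a b"
  obtains n :: nat and t where "t 0 = a" "t n = b"
    "\<And>i. i < n \<Longrightarrow> t i < t (Suc i) \<and> P {t i..t (Suc i)} f"
  using assms
proof (induction arbitrary: thesis rule: piecewise_on.induct)
  case (single a b)
  show ?case
    by (rule single.prems[of "\<lambda>i. if i = 0 then a else b" 1]) (use single in auto)
next
  case (step a b c)
  obtain n :: nat and t where t: "t 0 = b" "t n = c"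
    "\<And>i. i < n \<Longrightarrow> t i < t (Suc i) \<and> P {t i..t (Suc i)} f"
    using step.IH by blast
  show ?case
    by (rule step.prems[of "case_nat a t" "Suc n"])
      (use step t in \<open>auto split: nat.split\<close>)
qed

text \<open>The condition a \<noteq> b excludes n = 0, since \<open>piecewise_on\<close> knows no
  empty partition.\<close>

lemma piecewise_onI_partition:
  assumes "t 0 = a" "t n = b" "a \<noteq> b"
    "\<And>i. i < n \<Longrightarrow> t i < t (Suc i) \<and> P {t i..t (Suc i)} f"
  shows "piecewise_on P f a b"
  using assms
proof (induction n arbitrary: b)
  case (Suc n)
  have last: "piecewise_on P f (t n) b"
    using Suc.prems(2) Suc.prems(4)[of n] by (auto intro: single)
  show ?case
  proof (cases "t n = a")
    case False
    then have "piecewise_on P f a (t n)"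
      using Suc by (metis less_Suc_eq)
    then show ?thesis
      using last by (rule piecewise_on_trans)
  qed (use last in simp)
qed simp

text \<open>From here on induction over the pieces, on arbitrary intervals, replaces the indexed
  partitions of \<open>piecewise\<close>.\<close>

lemma piecewise_iff_piecewise_on: "piecewise P f \<longleftrightarrow> piecewise_on P f 0 1"
proof
  assume "piecewise P f"
  then show "piecewise_on P f 0 1"
    unfolding piecewise_def by (metis piecewise_onI_partition zero_neq_one)
next
  assume "piecewise_on P f 0 1"
  then show "piecewise P f"
    unfolding piecewise_def by (metis piecewise_onD_partition)
qed

definition affinely_stable :: "(real set \<Rightarrow> (real \<Rightarrow> 'a) \<Rightarrow> bool) \<Rightarrow> bool" where
  "affinely_stable P \<longleftrightarrow>
     (\<forall>a b c d q m f g. P {a..b} f \<and> m \<noteq> 0 \<and> c < d \<and>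
        (\<forall>t\<in>{c..d}. q + m * t \<in> {a..b} \<and> g t = f (q + m * t)) \<longrightarrow> P {c..d} g)"

lemma affinely_stableD:
  assumes "affinely_stable P" "P {a..b} f" "m \<noteq> 0" "c < d"
    "\<And>t. t \<in> {c..d} \<Longrightarrow> q + m * t \<in> {a..b}" "\<And>t. t \<in> {c..d} \<Longrightarrow> g t = f (q + m * t)"
  shows "P {c..d} g"
  using assms unfolding affinely_stable_def by blast

lemma affine_between:
  fixes m :: real
  assumes "t \<in> {c..d}" "q + m * c \<in> {a..b}" "q + m * d \<in> {a..b}"
  shows "q + m * t \<in> {a..b}"
proof (cases "m \<ge> 0")
  case True
  then have "m * c \<le> m * t" "m * t \<le> m * d"
    using assms(1) by (auto intro: mult_left_mono)
  then show ?thesis using assms(2,3) by auto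
next
  case False
  then have "m * t \<le> m * c" "m * d \<le> m * t"
    using assms(1) by (auto intro: mult_left_mono_neg)
  then show ?thesis using assms(2,3) by auto
qed

lemma affinely_stable_interval:
  assumes "affinely_stable P" "P {a..b} f" "m \<noteq> 0" "c < d"
    "q + m * c \<in> {a..b}" "q + m * d \<in> {a..b}" "\<And>t. t \<in> {c..d} \<Longrightarrow> g t = f (q + m * t)"
  shows "P {c..d} g"
  using affinely_stableD[OF assms(1-4) affine_between[OF _ assms(5,6)] assms(7)] .

text \<open>The image of {c..d} may be any part of {a..b}, so one lemma serves for restricting,
  rescaling and reversing.\<close>

lemma piecewise_on_affine:
  assumes P: "affinely_stable P" and f: "piecewise_on P f a b" and m: "m \<noteq> 0"
    and cd: "c < d" "q + m * c \<in> {a..b}" "q + m * d \<in> {a..b}"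
    and g: "\<And>t. t \<in> {c..d} \<Longrightarrow> g t = f (q + m * t)"
  shows "piecewise_on P g c d"
  using f cd g
proof (induction arbitrary: c d rule: piecewise_on.induct)
  case (single a b)
  show ?case
    using single.prems(1)
      affinely_stable_interval[OF P single.hyps(2) m single.prems(1-3) single.prems(4)]
    by (rule piecewise_on.single)
next
  case (step a b e)
  have first: "piecewise_on P g c' d'"
    if "c \<le> c'" "d' \<le> d" "c' < d'" "q + m * c' \<in> {a..b}" "q + m * d' \<in> {a..b}" for c' d'
  proof -
    have "g t = f (q + m * t)" if "t \<in> {c'..d'}" for t
      using that \<open>c \<le> c'\<close> \<open>d' \<le> d\<close> by (intro step.prems(4)) simp
    from that(3) affinely_stable_interval[OF P step.hyps(2) m that(3-5) this] show ?thesis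
      by (rule piecewise_on.single)
  qed
  have rest: "piecewise_on P g c' d'"
    if "c \<le> c'" "d' \<le> d" "c' < d'" "q + m * c' \<in> {b..e}" "q + m * d' \<in> {b..e}" for c' d'
  proof -
    have "g t = f (q + m * t)" if "t \<in> {c'..d'}" for t
      using that \<open>c \<le> c'\<close> \<open>d' \<le> d\<close> by (intro step.prems(4)) simp
    from step.IH[OF that(3-5) this] show ?thesis .
  qed
  \<comment> \<open>The preimage of the breakpoint b: either {c..d} is mapped to one side of b, or u
    cuts it into two intervals that are mapped to opposite sides, in an order given by the sign of
    m.\<close>
  define u where "u = (b - q) / m"
  have u: "q + m * u = b" using m by (simp add: u_def)
  have le: "a \<le> b" "b \<le> e" using step.hyps(1) piecewise_on_less[OF step.hyps(3)] by auto
  have ends: "a \<le> q + m * c" "q + m * c \<le> e" "a \<le> q + m * d" "q + m * d \<le> e"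
    using step.prems(2,3) by auto
  consider (below) "q + m * c \<le> b" "q + m * d \<le> b" | (above) "q + m * c \<ge> b" "q + m * d \<ge> b"
    | (up) "q + m * c < b" "q + m * d > b" | (down) "q + m * c > b" "q + m * d < b"
    by linarith
  then show ?case
  proof cases
    case below
    then show ?thesis using step.prems(1) ends by (intro first) simp_all
  next
    case above
    then show ?thesis using step.prems(1) ends by (intro rest) simp_all
  next
    case up
    then have "m * c < m * d" by linarith
    then have "m > 0" using step.prems(1) by (auto simp: mult_less_cancel_left)
    moreover have "m * c < m * u" "m * u < m * d" using up u by linarith+
    ultimately have "c < u" "u < d" by simp_all
    have "piecewise_on P g c u" "piecewise_on P g u d"
      using up u ends le \<open>c < u\<close> \<open>u < d\<close> by (intro first rest; simp)+
    then show ?thesis by (rule piecewise_on_trans)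
  next
    case down
    then have "m * d < m * c" by linarith
    then have "m < 0" using step.prems(1) by (auto simp: mult_less_cancel_left)
    moreover have "m * d < m * u" "m * u < m * c" using down u by linarith+
    ultimately have "c < u" "u < d" by simp_all
    have "piecewise_on P g c u" "piecewise_on P g u d"
      using down u ends le \<open>c < u\<close> \<open>u < d\<close> by (intro rest first; simp)+
    then show ?thesis by (rule piecewise_on_trans)
  qed
qed

section \<open>Smoothness under affine changes of coordinates\<close>

text \<open>Needed in two roles: with v a slope it is a change of parameter, with v = h it concerns
  the line along which \<open>dir_deriv\<close> differentiates.\<close>

lemma Ck_on_affine:
  fixes f :: "'a::real_normed_vector \<Rightarrow> 'b::real_normed_vector"
  assumes "Ck_on k U f"
  shows "Ck_on k {t. q + t *\<^sub>R v \<in> U} (\<lambda>t. f (q + t *\<^sub>R v))"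
  using assms
proof (induction k arbitrary: f)
  case 0
  have "continuous_on {t. q + t *\<^sub>R v \<in> U} (f \<circ> (\<lambda>t. q + t *\<^sub>R v))"
    using 0 by (intro continuous_on_compose continuous_intros) (auto elim: continuous_on_subset)
  then show ?case by (simp add: o_def)
next
  case (Suc k)
  then obtain f' where f': "\<And>x. x \<in> U \<Longrightarrow> (f has_derivative f' x) (at x)"
    "\<And>v. Ck_on k U (\<lambda>x. f' x v)" by auto
  have "((\<lambda>t. f (q + t *\<^sub>R v)) has_derivative (\<lambda>s. f' (q + t *\<^sub>R v) (s *\<^sub>R v))) (at t)"
    if "q + t *\<^sub>R v \<in> U" for t
    by (rule has_derivative_compose[where f = "\<lambda>t. q + t *\<^sub>R v", OF _ f'(1)[OF that]])
      (auto intro!: derivative_eq_intros)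
  moreover have "Ck_on k {t. q + t *\<^sub>R v \<in> U} (\<lambda>t. f' (q + t *\<^sub>R v) (s *\<^sub>R v))" for s
    using Suc.IH[OF f'(2)] .
  ultimately show ?case
    unfolding Ck_on.simps by (intro exI[of _ "\<lambda>t s. f' (q + t *\<^sub>R v) (s *\<^sub>R v)"]) auto
qed

text \<open>Differentiation kills the constant, so q is generalized in the induction and the
  hypothesis is applied with 0.\<close>

lemma Ck_on_affine_image:
  fixes f :: "'a::real_normed_vector \<Rightarrow> real"
  assumes "Ck_on k U f"
  shows "Ck_on k U (\<lambda>x. q + p * f x)"
  using assms
proof (induction k arbitrary: f q)
  case (Suc k)
  then obtain f' where f': "\<And>x. x \<in> U \<Longrightarrow> (f has_derivative f' x) (at x)"
    "\<And>v. Ck_on k U (\<lambda>x. f' x v)" by auto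
  have "((\<lambda>x. q + p * f x) has_derivative (\<lambda>v. 0 + p * f' x v)) (at x)" if "x \<in> U" for x
    using f'(1)[OF that] by (auto intro!: derivative_eq_intros)
  then show ?case using Suc.IH[OF f'(2), of 0] by force
qed (auto intro!: continuous_intros)

text \<open>On an open set f and g have the same derivatives, so the derivative family of f serves
  for g and no induction is required.\<close>

lemma Ck_on_cong:
  assumes "open U" "\<And>x. x \<in> U \<Longrightarrow> f x = g x" "Ck_on k U f"
  shows "Ck_on k U g"
proof (cases k)
  case 0
  then show ?thesis using assms by (simp cong: continuous_on_cong)
next
  case (Suc k')
  then obtain f' where "\<And>x. x \<in> U \<Longrightarrow> (f has_derivative f' x) (at x)"
    "\<And>v. Ck_on k' U (\<lambda>x. f' x v)" using assms by auto
  moreover from this have "(g has_derivative f' x) (at x)" if "x \<in> U" for x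
    using has_derivative_transform_within_open[of f "f' x" x UNIV U g] that assms(1,2) by simp
  ultimately show ?thesis
    using Suc by auto
qed

lemma Ck_on_vector_derivative:
  fixes f :: "real \<Rightarrow> 'b::real_normed_vector"
  assumes "open U" "Ck_on (Suc k) U f"
  shows "Ck_on k U (\<lambda>t. vector_derivative f (at t))"
proof -
  obtain f' where f': "\<And>x. x \<in> U \<Longrightarrow> (f has_derivative f' x) (at x)"
    "\<And>v. Ck_on k U (\<lambda>x. f' x v)" using assms by auto
  have eq: "f' x 1 = vector_derivative f (at x)" if "x \<in> U" for x
  proof -
    have "linear (f' x)"
      using f'(1)[OF that] by (rule has_derivative_linear)
    \<comment> \<open>A linear map on the real line is determined by its value at 1.\<close>
    from linear_scale[OF this, of _ 1] have "f' x = (\<lambda>s. s *\<^sub>R f' x 1)"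
      unfolding real_scaleR_def mult_1_right by (rule ext)
    then have "(f has_vector_derivative f' x 1) (at x)"
      unfolding has_vector_derivative_def by (rule subst) (rule f'(1)[OF that])
    then show ?thesis
      by (simp add: vector_derivative_at)
  qed
  show ?thesis
    using eq by (rule Ck_on_cong[OF assms(1) _ f'(2)[of 1]])
qed

lemma Ck_on_has_vector_derivative:
  fixes f :: "real \<Rightarrow> 'b::real_normed_vector"
  assumes "Ck_on (Suc k) U f" "t \<in> U"
  shows "(f has_vector_derivative vector_derivative f (at t)) (at t)"
  using assms by (auto simp flip: vector_derivative_works intro: differentiableI)

lemma smooth_iterated_derivative:
  fixes f :: "real \<Rightarrow> 'b::real_normed_vector"
  assumes "open U" "\<And>k. Ck_on k U f"
  shows "Ck_on k U (((\<lambda>g t. vector_derivative g (at t)) ^^ n) f)"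
  by (induction n arbitrary: k) (use assms in \<open>auto intro: Ck_on_vector_derivative simp del: Ck_on.simps\<close>)

text \<open>Gives the Taylor coefficients of q + p f. The induction hypothesis holds on U only;
  openness of U suffices for passing to the next derivative.\<close>

lemma iterated_derivative_affine_image:
  fixes f :: "real \<Rightarrow> real"
  assumes "open U" "\<And>k. Ck_on k U f" "t \<in> U"
  shows "((\<lambda>g t. vector_derivative g (at t)) ^^ n) (\<lambda>t. q + p * f t) t =
    (if n = 0 then q else 0) + p * ((\<lambda>g t. vector_derivative g (at t)) ^^ n) f t"
  using assms(3)
proof (induction n arbitrary: t)
  case (Suc n)
  let ?D = "\<lambda>n. (\<lambda>g t. vector_derivative g (at t)) ^^ n"
  have "(?D n f has_vector_derivative ?D (Suc n) f t) (at t)"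
    using Ck_on_has_vector_derivative[OF smooth_iterated_derivative[OF assms(1,2)] Suc.prems]
    by simp
  then have "((\<lambda>t. (if n = 0 then q else 0) + p * ?D n f t) has_vector_derivative
      (p * ?D (Suc n) f t)) (at t)"
    by (auto intro!: derivative_eq_intros simp: has_real_derivative_iff_has_vector_derivative[symmetric])
  then have "(?D n (\<lambda>t. q + p * f t) has_vector_derivative (p * ?D (Suc n) f t)) (at t)"
    by (rule has_vector_derivative_transform_within_open[OF _ assms(1) Suc.prems]) (simp add: Suc.IH)
  then show ?case by (simp add: vector_derivative_at)
qed simp

text \<open>In the analytic case the Taylor series of t \<mapsto> f (q + m t) in direction h is that
  of f in direction m h, whence the radius \<epsilon> / |m|.\<close>

lemma Cr_on_affine:
  fixes f :: "real \<Rightarrow> 'b::real_normed_vector"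
  assumes "Cr_on r U f" "m \<noteq> 0"
  shows "Cr_on r {t. q + m * t \<in> U} (\<lambda>t. f (q + m * t))"
proof -
  have Ck: "Ck_on k {t. q + m * t \<in> U} (\<lambda>t. f (q + m * t))" if "Ck_on k U f" for k
    using Ck_on_affine[OF that, of q m] by (simp add: mult.commute)
  have "analytic_at_pt (\<lambda>t. f (q + m * t)) t" if an: "analytic_at_pt f (q + m * t)" for t
  proof -
    obtain \<epsilon> where \<epsilon>: "\<epsilon> > 0"
      "\<And>h. norm h < \<epsilon> \<Longrightarrow> (\<lambda>n. dir_deriv n f (q + m * t) h /\<^sub>R fact n) sums f (q + m * t + h)"
      using an unfolding analytic_at_pt_def by blast
    have dir: "dir_deriv n (\<lambda>t. f (q + m * t)) t h = dir_deriv n f (q + m * t) (m * h)" for n h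
      by (simp add: dir_deriv_def algebra_simps)
    have add: "q + m * (t + h) = q + m * t + m * h" for h
      by (simp add: algebra_simps)
    have "(\<lambda>n. dir_deriv n (\<lambda>t. f (q + m * t)) t h /\<^sub>R fact n) sums f (q + m * (t + h))"
      if "norm h < \<epsilon> / \<bar>m\<bar>" for h
      unfolding dir add using that \<open>m \<noteq> 0\<close>
      by (intro \<epsilon>(2)) (simp add: abs_mult pos_less_divide_eq mult.commute)
    moreover have "\<epsilon> / \<bar>m\<bar> > 0" using \<epsilon>(1) \<open>m \<noteq> 0\<close> by simp
    ultimately show ?thesis unfolding analytic_at_pt_def by blast
  qed
  then show ?thesis using assms(1) Ck by (cases r) auto
qed

lemma Cr_on_affine_image:
  fixes f :: "real \<Rightarrow> real"
  assumes "Cr_on r U f" "open U"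
  shows "Cr_on r U (\<lambda>t. q + p * f t)"
proof -
  have "analytic_at_pt (\<lambda>t. q + p * f t) x"
    if an: "analytic_at_pt f x" and smooth: "\<And>k. Ck_on k U f" and "x \<in> U" for x
  proof -
    obtain \<epsilon> where \<epsilon>: "\<epsilon> > 0"
      "\<And>h. norm h < \<epsilon> \<Longrightarrow> (\<lambda>n. dir_deriv n f x h /\<^sub>R fact n) sums f (x + h)"
      using an unfolding analytic_at_pt_def by blast
    have "(\<lambda>n. dir_deriv n (\<lambda>t. q + p * f t) x h /\<^sub>R fact n) sums (q + p * f (x + h))"
      if "norm h < \<epsilon>" for h
    proof -
      have op: "open {t. x + t *\<^sub>R h \<in> U}"
        using open_vimage[OF \<open>open U\<close>, of "\<lambda>t. x + t *\<^sub>R h"]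
        by (simp add: vimage_def continuous_intros)
      have "dir_deriv n (\<lambda>t. q + p * f t) x h = (if n = 0 then q else 0) + p * dir_deriv n f x h" for n
        unfolding dir_deriv_def
        by (rule iterated_derivative_affine_image[OF op Ck_on_affine[OF smooth]]) (use \<open>x \<in> U\<close> in simp)
      \<comment> \<open>The constant q enters the term of order 0 only, so the new series is the sum
        of a one-term series and a multiple of the old one, with the same radius.\<close>
      then have eq: "(\<lambda>n. dir_deriv n (\<lambda>t. q + p * f t) x h /\<^sub>R fact n) =
          (\<lambda>n. (if n = 0 then q else 0) + p * (dir_deriv n f x h /\<^sub>R fact n))"
        by (auto simp: fun_eq_iff algebra_simps)
      have "(\<lambda>n. if n = 0 then q else 0) sums q"
        using sums_single[of 0 "\<lambda>_. q"] by simp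
      then show ?thesis
        unfolding eq by (rule sums_add) (rule sums_mult[OF \<epsilon>(2)[OF that]])
    qed
    then show ?thesis using \<epsilon>(1) unfolding analytic_at_pt_def by blast
  qed
  then show ?thesis
    using assms by (cases r) (simp_all add: Ck_on_affine_image)
qed

section \<open>Curves and embeddings under affine changes of parameter\<close>

lemma curve_rep_affine:
  assumes "curve_rep r A {a..b} \<gamma> (q + m * t) g" "m \<noteq> 0"
    "\<And>s. s \<in> {c..d} \<Longrightarrow> q + m * s \<in> {a..b}" "\<And>s. s \<in> {c..d} \<Longrightarrow> \<gamma>' s = \<gamma> (q + m * s)"
  shows "curve_rep r A {c..d} \<gamma>' t (\<lambda>s. g (q + m * s))"
proof -
  obtain U \<phi> W where W: "(U, \<phi>) \<in> A" "open W" "q + m * t \<in> W" "Cr_on r W g"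
    "\<And>s. s \<in> W \<inter> {a..b} \<Longrightarrow> \<gamma> s \<in> U \<and> \<phi> (\<gamma> s) = g s"
    using assms(1) unfolding curve_rep_def by fast
  have "open {s. q + m * s \<in> W}"
    using open_vimage[OF W(2), of "\<lambda>s. q + m * s"] by (simp add: vimage_def continuous_intros)
  then show ?thesis
    unfolding curve_rep_def
    using W assms(3,4) Cr_on_affine[OF W(4) assms(2)]
    by (intro bexI[OF _ W(1)] case_prodI exI[of _ "{s. q + m * s \<in> W}"]) auto
qed

lemma affinely_stable_Cr_curve: "affinely_stable (Cr_curve r A)"
  unfolding affinely_stable_def Cr_curve_def by (blast intro: curve_rep_affine)

text \<open>For \<open>C_fin 0\<close> the vector derivative might be a mere default value, for
  which the chain rule fails.\<close>

lemma curve_rep_differentiable: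
  assumes "curve_rep r A J \<gamma> t g" "r \<noteq> C_fin 0"
  shows "(g has_vector_derivative vector_derivative g (at t)) (at t)"
proof -
  obtain W where "t \<in> W" "Cr_on r W g"
    using assms(1) unfolding curve_rep_def by blast
  moreover from this(2) assms(2) have "\<exists>k. Ck_on (Suc k) W g"
  proof (cases r)
    case (C_fin k)
    with \<open>Cr_on r W g\<close> assms(2) show ?thesis by (cases k) auto
  qed (auto simp del: Ck_on.simps)
  ultimately show ?thesis using Ck_on_has_vector_derivative by blast
qed

text \<open>The affine map embeds {c..d} into {a..b}, and embeddings compose.\<close>

lemma embedding_map_affine:
  fixes q m :: real
  assumes "embedding_map (top_of_set {a..b}) X \<gamma>" "m \<noteq> 0"
    "\<And>s. s \<in> {c..d} \<Longrightarrow> q + m * s \<in> {a..b}" "\<And>s. s \<in> {c..d} \<Longrightarrow> \<gamma>' s = \<gamma> (q + m * s)"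
  shows "embedding_map (top_of_set {c..d}) X \<gamma>'"
proof -
  have "homeomorphism {c..d} ((\<lambda>s. q + m * s) ` {c..d}) (\<lambda>s. q + m * s) (\<lambda>s. (s - q) / m)"
    using assms(2) by (intro homeomorphismI continuous_intros) auto
  then have "homeomorphic_map (top_of_set {c..d})
      (subtopology (top_of_set {a..b}) ((\<lambda>s. q + m * s) ` {c..d})) (\<lambda>s. q + m * s)"
    using assms(3)
    by (auto simp: subtopology_subtopology Int_absorb1 image_subset_iff homeomorphic_map_maps
        homeomorphic_maps_def homeomorphism_def)
  then have "embedding_map (top_of_set {c..d}) (top_of_set {a..b}) (\<lambda>s. q + m * s)"
    by (simp add: embedding_map_def)
  then have "embedding_map (top_of_set {c..d}) X (\<gamma> \<circ> (\<lambda>s. q + m * s))"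
    using assms(1) by (rule embedding_map_compose)
  then show ?thesis
    by (rule embedding_map_eq) (use assms(4) in auto)
qed

text \<open>The velocity is multiplied by m and hence stays nonzero.\<close>

lemma affinely_stable_Cr_embedding:
  assumes "r \<noteq> C_fin 0"
  shows "affinely_stable (Cr_embedding r X A)"
proof -
  have "Cr_embedding r X A {c..d} \<gamma>'"
    if emb: "Cr_embedding r X A {a..b} \<gamma>" and m: "m \<noteq> 0"
      and aff: "\<And>t. t \<in> {c..d} \<Longrightarrow> q + m * t \<in> {a..b}" "\<And>t. t \<in> {c..d} \<Longrightarrow> \<gamma>' t = \<gamma> (q + m * t)"
    for a b c d q m \<gamma> \<gamma>'
  proof -
    have "\<exists>g. curve_rep r A {c..d} \<gamma>' t g \<and> vector_derivative g (at t) \<noteq> 0" if "t \<in> {c..d}" for t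
    proof -
      obtain g where g: "curve_rep r A {a..b} \<gamma> (q + m * t) g"
        "vector_derivative g (at (q + m * t)) \<noteq> 0"
        using emb aff(1)[OF \<open>t \<in> {c..d}\<close>] unfolding Cr_embedding_def by blast
      have "((\<lambda>s. q + m * s) has_vector_derivative m) (at t)"
        by (auto intro!: derivative_eq_intros
            simp: has_real_derivative_iff_has_vector_derivative[symmetric])
      then have "((\<lambda>s. g (q + m * s)) has_vector_derivative
          m *\<^sub>R vector_derivative g (at (q + m * t))) (at t)"
        using vector_diff_chain_at[where f = "\<lambda>s. q + m * s",
            OF _ curve_rep_differentiable[OF g(1) assms]]
        by (auto simp: o_def)
      then show ?thesis
        using curve_rep_affine[OF g(1) m aff] g(2) m by (metis scaleR_eq_0_iff vector_derivative_at)
    qed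
    moreover have "embedding_map (top_of_set {a..b}) X \<gamma>"
      using emb unfolding Cr_embedding_def by blast
    from embedding_map_affine[OF this m aff] have "embedding_map (top_of_set {c..d}) X \<gamma>'" .
    ultimately show ?thesis
      unfolding Cr_embedding_def by blast
  qed
  then show ?thesis unfolding affinely_stable_def by blast
qed

lemma affinely_stable_piece:
  assumes "r \<noteq> C_fin 0"
  shows "affinely_stable (piece r k X A)"
proof (cases k)
  case Embedded_or_const
  show ?thesis
    using affinely_stable_Cr_embedding[OF assms, of X A]
    unfolding affinely_stable_def Embedded_or_const piece.simps by (metis (no_types, lifting))
qed (use affinely_stable_Cr_curve[of r A] affinely_stable_Cr_embedding[OF assms, of X A]
    in \<open>simp_all add: affinely_stable_def\<close>)

section \<open>Reparametrizations of intervals\<close>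

text \<open>The breakpoints are moved by h. With h = \<open>id\<close> this changes the function
  piece by piece; with h a reparametrization it transports a partition from one path to
  another.\<close>

lemma piecewise_on_map:
  assumes "piecewise_on P f a b" "strict_mono_on {a..b} h"
    "\<And>c d. a \<le> c \<Longrightarrow> c < d \<Longrightarrow> d \<le> b \<Longrightarrow> P {c..d} f \<Longrightarrow> Q {h c..h d} g"
  shows "piecewise_on Q g (h a) (h b)"
  using assms
proof (induction rule: piecewise_on.induct)
  case (single a b)
  then show ?case
    by (intro piecewise_on.single) (auto simp: strict_mono_on_def)
next
  case (step a b c)
  have "b < c" using piecewise_on_less[OF step.hyps(3)] .
  have "piecewise_on Q g (h b) (h c)"
    using step.hyps(1) by (intro step.IH step.prems(2) monotone_on_subset[OF step.prems(1)]) auto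
  moreover have "h a < h b" "Q {h a..h b} g"
    using step.hyps(1,2) step.prems \<open>b < c\<close> by (auto simp: strict_mono_on_def)
  ultimately show ?case by (auto intro: piecewise_on.step)
qed

lemma piecewise_on_cong:
  assumes "affinely_stable P" "piecewise_on P f a b" "\<And>t. t \<in> {a..b} \<Longrightarrow> g t = f t"
  shows "piecewise_on P g a b"
  using assms(3) piecewise_on_less[OF assms(2)]
  by (intro piecewise_on_affine[OF assms(1,2), where q = 0 and m = 1]) auto

abbreviation real_Cr_curve :: "regularity \<Rightarrow> real set \<Rightarrow> (real \<Rightarrow> real) \<Rightarrow> bool" where
  "real_Cr_curve r \<equiv> Cr_curve r {(UNIV, id)}"

lemma real_Cr_curve_iff:
  "real_Cr_curve r J f \<longleftrightarrow>
     (\<forall>t\<in>J. \<exists>g W. open W \<and> t \<in> W \<and> Cr_on r W g \<and> (\<forall>s\<in>W \<inter> J. f s = g s))"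
  unfolding Cr_curve_def curve_rep_def by auto

lemma real_Cr_curve_affine_image:
  assumes "real_Cr_curve r J f" "\<And>t. t \<in> J \<Longrightarrow> g t = q + p * f t"
  shows "real_Cr_curve r J g"
  unfolding real_Cr_curve_iff
proof
  fix t assume "t \<in> J"
  then obtain h W where "open W" "t \<in> W" "Cr_on r W h" "\<forall>s\<in>W \<inter> J. f s = h s"
    using assms(1) unfolding real_Cr_curve_iff by blast
  then show "\<exists>h W. open W \<and> t \<in> W \<and> Cr_on r W h \<and> (\<forall>s\<in>W \<inter> J. g s = h s)"
    using Cr_on_affine_image[of r W h q p] assms(2) by (intro exI[of _ "\<lambda>t. q + p * h t"] exI[of _ W]) auto
qed

lemma Ck_on_const: "Ck_on k U (\<lambda>_. c)"
proof (induction k arbitrary: c)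
  case (Suc k)
  then show ?case unfolding Ck_on.simps by (intro exI[of _ "\<lambda>_ _. 0"]) auto
qed auto

text \<open>Makes the identity a reparametrization, also for \<open>C_omega\<close>: its Taylor
  series stops after the linear term.\<close>

lemma Cr_on_id: "Cr_on r U (\<lambda>t::real. t)"
proof -
  have smooth: "Ck_on k U (\<lambda>t::real. t)" for k
    using Ck_on_const[of _ U] by (cases k) (auto intro!: exI[of _ "\<lambda>_ v. v"])
  let ?D = "\<lambda>g t. vector_derivative g (at t)"
  have "(?D ^^ n) (\<lambda>_. c::real) = (\<lambda>_. if n = 0 then c else 0)" for n c
    by (induction n) simp_all
  moreover have "?D (\<lambda>t. x + t * h) = (\<lambda>_. h)" for x h :: real
    by (auto intro!: vector_derivative_at derivative_eq_intros
        simp flip: has_real_derivative_iff_has_vector_derivative)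
  ultimately have "dir_deriv n (\<lambda>t. t) x h /\<^sub>R fact n = (if n = 0 then x else if n = 1 then h else 0)"
    for n and x h :: real
    unfolding dir_deriv_def by (cases n) (simp_all add: funpow_Suc_right del: funpow.simps(2))
  moreover have "(\<lambda>n. if n = 0 then x else if n = 1 then h else 0) sums (x + h)" for x h :: real
    using sums_finite[of "{0, 1}" "\<lambda>n::nat. if n = 0 then x else if n = 1 then h else 0"] by simp
  ultimately have "analytic_at_pt (\<lambda>t. t) x" for x :: real
    unfolding analytic_at_pt_def by (auto intro!: exI[of _ 1])
  then show ?thesis using smooth by (cases r) auto
qed

text \<open>The inverse is carried along explicitly, which makes the notion symmetric. Source and
  target are arbitrary intervals, so that a reparametrization can be cut into parts and such parts
  can be glued.\<close>

definition interval_diffeo ::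
  "regularity \<Rightarrow> (real \<Rightarrow> real) \<Rightarrow> (real \<Rightarrow> real) \<Rightarrow> real \<Rightarrow> real \<Rightarrow> real \<Rightarrow> real \<Rightarrow> bool" where
  "interval_diffeo r \<phi> \<psi> a b c d \<longleftrightarrow> a < b \<and> c < d \<and>
     (\<forall>t\<in>{a..b}. \<phi> t \<in> {c..d} \<and> \<psi> (\<phi> t) = t) \<and> (\<forall>s\<in>{c..d}. \<psi> s \<in> {a..b} \<and> \<phi> (\<psi> s) = s) \<and>
     strict_mono_on {a..b} \<phi> \<and> strict_mono_on {c..d} \<psi> \<and>
     piecewise_on (real_Cr_curve r) \<phi> a b \<and> piecewise_on (real_Cr_curve r) \<psi> c d"

lemma interval_diffeo_sym: "interval_diffeo r \<phi> \<psi> a b c d \<Longrightarrow> interval_diffeo r \<psi> \<phi> c d a b"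
  by (auto simp: interval_diffeo_def)

lemma strict_mono_on_right_inverse:
  fixes f g :: "real \<Rightarrow> real"
  assumes "strict_mono_on S f" "\<And>y. y \<in> V \<Longrightarrow> g y \<in> S \<and> f (g y) = y"
  shows "strict_mono_on V g"
proof (rule strict_mono_onI)
  fix x y assume "x \<in> V" "y \<in> V" "x < y"
  then show "g x < g y"
    using assms by (metis linorder_not_less order_less_le strict_mono_on_leD)
qed

lemma interval_diffeoI:
  assumes "a < b" "c < d" "\<And>t. t \<in> {a..b} \<Longrightarrow> \<phi> t \<in> {c..d} \<and> \<psi> (\<phi> t) = t"
    "\<And>s. s \<in> {c..d} \<Longrightarrow> \<psi> s \<in> {a..b} \<and> \<phi> (\<psi> s) = s" "strict_mono_on {a..b} \<phi>"
    "piecewise_on (real_Cr_curve r) \<phi> a b" "piecewise_on (real_Cr_curve r) \<psi> c d"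
  shows "interval_diffeo r \<phi> \<psi> a b c d"
  using assms strict_mono_on_right_inverse[OF assms(5,4)] unfolding interval_diffeo_def by blast

lemma interval_diffeoD:
  assumes "interval_diffeo r \<phi> \<psi> a b c d"
  shows "a < b" "c < d" "t \<in> {a..b} \<Longrightarrow> \<phi> t \<in> {c..d}" "t \<in> {a..b} \<Longrightarrow> \<psi> (\<phi> t) = t"
    "s \<in> {c..d} \<Longrightarrow> \<psi> s \<in> {a..b}" "s \<in> {c..d} \<Longrightarrow> \<phi> (\<psi> s) = s"
    "strict_mono_on {a..b} \<phi>" "strict_mono_on {c..d} \<psi>"
    "piecewise_on (real_Cr_curve r) \<phi> a b" "piecewise_on (real_Cr_curve r) \<psi> c d"
  using assms unfolding interval_diffeo_def by blast+

text \<open>The end points c and d are attained, and by monotonicity only at a and b.\<close>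

lemma interval_diffeo_endpoints:
  assumes "interval_diffeo r \<phi> \<psi> a b c d"
  shows "\<phi> a = c" "\<phi> b = d"
proof -
  note D = interval_diffeoD[OF assms]
  have "\<phi> a \<le> \<phi> (\<psi> c)" "\<phi> (\<psi> d) \<le> \<phi> b"
    using D(1,2) D(5)[of c] D(5)[of d] by (auto intro!: strict_mono_on_leD[OF D(7)])
  then show "\<phi> a = c" "\<phi> b = d"
    using D(1,2) D(3)[of a] D(3)[of b] by (simp_all add: D(6))
qed

lemma interval_diffeo_restrict:
  assumes "interval_diffeo r \<phi> \<psi> a b c d" "a \<le> a'" "a' < b'" "b' \<le> b"
  shows "interval_diffeo r \<phi> \<psi> a' b' (\<phi> a') (\<phi> b')"
proof -
  note D = interval_diffeoD[OF assms(1)]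
  have mem: "a' \<in> {a..b}" "b' \<in> {a..b}" using assms(2-) by auto
  have lt: "\<phi> a' < \<phi> b'" using D(7) mem \<open>a' < b'\<close> by (simp add: strict_mono_on_def)
  have sub: "{\<phi> a'..\<phi> b'} \<subseteq> {c..d}" using D(3)[OF mem(1)] D(3)[OF mem(2)] by auto
  have pw: "piecewise_on (real_Cr_curve r) f u' v'"
    if "piecewise_on (real_Cr_curve r) f u v" "u \<le> u'" "u' < v'" "v' \<le> v" for f u v u' v'
    using that(2-) by (intro piecewise_on_affine[OF affinely_stable_Cr_curve that(1), where q = 0 and m = 1]) auto
  show ?thesis
  proof (rule interval_diffeoI)
    fix t assume t: "t \<in> {a'..b'}"
    then have "\<phi> a' \<le> \<phi> t" "\<phi> t \<le> \<phi> b'"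
      using assms(2-) by (auto intro!: strict_mono_on_leD[OF D(7)])
    then show "\<phi> t \<in> {\<phi> a'..\<phi> b'} \<and> \<psi> (\<phi> t) = t" using t assms(2-) D(4) by simp
  next
    fix s assume s: "s \<in> {\<phi> a'..\<phi> b'}"
    then have "\<psi> (\<phi> a') \<le> \<psi> s" "\<psi> s \<le> \<psi> (\<phi> b')"
      using sub lt by (auto intro!: strict_mono_on_leD[OF D(8)])
    moreover have "\<phi> (\<psi> s) = s" using sub s D(6) by blast
    ultimately show "\<psi> s \<in> {a'..b'} \<and> \<phi> (\<psi> s) = s" using D(4) mem by simp
  next
    show "piecewise_on (real_Cr_curve r) \<psi> (\<phi> a') (\<phi> b')"
      using sub lt by (intro pw[OF D(10)]) auto
  qed (use assms lt in \<open>auto intro: pw[OF D(9)] monotone_on_subset[OF D(7)]\<close>)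
qed

text \<open>Rescaling the source changes the inverse by an affine map applied after \<psi>; this is
  why smoothness of q + p f was needed besides that of f (q + m t).\<close>

lemma interval_diffeo_affine:
  assumes "interval_diffeo r \<phi> \<psi> a b c d" "m > 0" "q + m * a' = a" "q + m * b' = b"
    "\<And>t. t \<in> {a'..b'} \<Longrightarrow> \<phi>' t = \<phi> (q + m * t)" "\<And>s. s \<in> {c..d} \<Longrightarrow> \<psi>' s = (\<psi> s - q) / m"
  shows "interval_diffeo r \<phi>' \<psi>' a' b' c d"
proof -
  note D = interval_diffeoD[OF assms(1)]
  have "m * a' < m * b'" using D(1) assms(3,4) by linarith
  then have "a' < b'" using \<open>m > 0\<close> by simp
  have im: "q + m * t \<in> {a..b}" if "t \<in> {a'..b'}" for t
    using affine_between[OF that, of q m a b] assms(3,4) D(1) by auto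
  show ?thesis
  proof (rule interval_diffeoI)
    fix t assume "t \<in> {a'..b'}"
    then show "\<phi>' t \<in> {c..d} \<and> \<psi>' (\<phi>' t) = t"
      using D(3,4)[OF im] \<open>m > 0\<close> by (simp add: assms(5,6))
  next
    fix s assume s: "s \<in> {c..d}"
    have "a \<le> \<psi> s" "\<psi> s \<le> b" using D(5)[OF s] by auto
    then have "\<psi>' s \<in> {a'..b'}"
      using \<open>m > 0\<close> assms(3,4) by (auto simp: assms(6)[OF s] field_simps)
    moreover have "q + m * \<psi>' s = \<psi> s"
      using \<open>m > 0\<close> by (simp add: assms(6)[OF s])
    ultimately show "\<psi>' s \<in> {a'..b'} \<and> \<phi>' (\<psi>' s) = s"
      using D(6)[OF s] by (simp add: assms(5))
  next
    show "strict_mono_on {a'..b'} \<phi>'"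
      using \<open>m > 0\<close> by (intro strict_mono_onI) (auto simp: assms(5) intro!: strict_mono_onD[OF D(7)] im)
  next
    show "piecewise_on (real_Cr_curve r) \<phi>' a' b'"
      using \<open>a' < b'\<close> \<open>m > 0\<close> im
      by (intro piecewise_on_affine[OF affinely_stable_Cr_curve D(9), where q = q and m = m])
        (auto simp: assms(5))
  next
    show "piecewise_on (real_Cr_curve r) \<psi>' c d"
    proof (rule piecewise_on_map[OF D(10), where h = id, simplified])
      fix u v assume "c \<le> u" "u < v" "v \<le> d" "real_Cr_curve r {u..v} \<psi>"
      then show "real_Cr_curve r {u..v} \<psi>'"
        by (elim real_Cr_curve_affine_image[where q = "- q / m" and p = "1 / m"])
          (simp add: assms(6) diff_divide_distrib)
    qed (simp add: strict_mono_on_def)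
  qed (use D \<open>a' < b'\<close> in auto)
qed

lemma interval_diffeo_affine_image:
  assumes "interval_diffeo r \<phi> \<psi> a b c d" "m > 0" "q + m * c' = c" "q + m * d' = d"
    "\<And>t. t \<in> {a..b} \<Longrightarrow> \<phi>' t = (\<phi> t - q) / m" "\<And>s. s \<in> {c'..d'} \<Longrightarrow> \<psi>' s = \<psi> (q + m * s)"
  shows "interval_diffeo r \<phi>' \<psi>' a b c' d'"
  using interval_diffeo_affine[OF interval_diffeo_sym[OF assms(1)] assms(2-4,6,5)]
  by (simp add: interval_diffeo_sym)

text \<open>Nothing has to match at the joint except the values, since the joint becomes a
  breakpoint of the partitions.\<close>

lemma interval_diffeo_join:
  assumes "interval_diffeo r \<phi>1 \<psi>1 a b c d" "interval_diffeo r \<phi>2 \<psi>2 b e d f"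
  shows "interval_diffeo r (\<lambda>t. if t \<le> b then \<phi>1 t else \<phi>2 t) (\<lambda>s. if s \<le> d then \<psi>1 s else \<psi>2 s) a e c f"
    (is "interval_diffeo r ?\<phi> ?\<psi> a e c f")
proof -
  note D = interval_diffeoD[OF assms(1)] and E = interval_diffeoD[OF assms(2)]
  have ends: "\<phi>1 b = d" "\<phi>2 b = d" "\<psi>1 d = b" "\<psi>2 d = b"
    using assms[THEN interval_diffeo_endpoints(1)] assms[THEN interval_diffeo_endpoints(2)]
      assms[THEN interval_diffeo_sym, THEN interval_diffeo_endpoints(1)]
      assms[THEN interval_diffeo_sym, THEN interval_diffeo_endpoints(2)] by auto
  \<comment> \<open>Points strictly beyond one joint go strictly beyond the other, so the two case
    distinctions select corresponding branches.\<close>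
  have above: "d < \<phi>2 t" if "b < t" "t \<le> e" for t
    using strict_mono_onD[OF E(7), of b t] that E(1) ends by simp
  have above': "b < \<psi>2 s" if "d < s" "s \<le> f" for s
    using strict_mono_onD[OF E(8), of d s] that E(2) ends by simp
  have pw: "piecewise_on (real_Cr_curve r) (\<lambda>t. if t \<le> v then g t else h t) u w"
    if "piecewise_on (real_Cr_curve r) g u v" "piecewise_on (real_Cr_curve r) h v w" "g v = h v"
    for g h u v w
    using that(3)
    by (intro piecewise_on_trans[of _ _ u v w]
        piecewise_on_cong[OF affinely_stable_Cr_curve that(1)]
        piecewise_on_cong[OF affinely_stable_Cr_curve that(2)]) auto
  show ?thesis
  proof (rule interval_diffeoI)
    fix t assume t: "t \<in> {a..e}"
    show "?\<phi> t \<in> {c..f} \<and> ?\<psi> (?\<phi> t) = t"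
    proof (cases "t \<le> b")
      case True
      then have "t \<in> {a..b}" using t by simp
      with D(3)[OF this] D(4)[OF this] E(2) True show ?thesis by auto
    next
      case False
      then have "t \<in> {b..e}" using t by simp
      with E(3)[OF this] E(4)[OF this] D(2) False above[of t] show ?thesis by auto
    qed
  next
    fix s assume s: "s \<in> {c..f}"
    show "?\<psi> s \<in> {a..e} \<and> ?\<phi> (?\<psi> s) = s"
    proof (cases "s \<le> d")
      case True
      then have "s \<in> {c..d}" using s by simp
      with D(5)[OF this] D(6)[OF this] E(1) True show ?thesis by auto
    next
      case False
      then have "s \<in> {d..f}" using s by simp
      with E(5)[OF this] E(6)[OF this] D(1) False above'[of s] show ?thesis by auto
    qed
  next
    show "strict_mono_on {a..e} ?\<phi>"
    proof (rule strict_mono_onI)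
      fix s t assume st: "s \<in> {a..e}" "t \<in> {a..e}" "s < t"
      show "?\<phi> s < ?\<phi> t"
        using st strict_mono_onD[OF D(7), of s t] strict_mono_onD[OF E(7), of s t]
          D(3)[of s] above[of t] by auto
    qed
  next
    show "piecewise_on (real_Cr_curve r) ?\<phi> a e"
      using D(9) E(9) ends by (intro pw) simp_all
    show "piecewise_on (real_Cr_curve r) ?\<psi> c f"
      using D(10) E(10) ends by (intro pw) simp_all
  qed (use D(1,2) E(1,2) in auto)
qed

lemma interval_diffeo_id: "interval_diffeo r (\<lambda>t. t) (\<lambda>t. t) 0 1 0 1"
proof -
  have "real_Cr_curve r {0..1} (\<lambda>t. t)"
    unfolding real_Cr_curve_iff using Cr_on_id by blast
  then have "piecewise_on (real_Cr_curve r) (\<lambda>t. t) 0 1"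
    by (intro piecewise_on.single) simp_all
  then show ?thesis by (intro interval_diffeoI) (auto simp: strict_mono_on_def)
qed

lemma reparametrization_iff: "reparametrization r \<phi> \<longleftrightarrow> (\<exists>\<psi>. interval_diffeo r \<phi> \<psi> 0 1 0 1)"
proof
  assume \<phi>: "reparametrization r \<phi>"
  then have bij: "bij_betw \<phi> {0..1} {0..1}" by (simp add: reparametrization_def)
  have "interval_diffeo r \<phi> (inv_into {0..1} \<phi>) 0 1 0 1"
    using \<phi> bij_betw_inv_into_left[OF bij] bij_betw_inv_into_right[OF bij]
      bij_betwE[OF bij] bij_betwE[OF bij_betw_inv_into[OF bij]]
    by (intro interval_diffeoI) (simp_all add: reparametrization_def piecewise_iff_piecewise_on)
  then show "\<exists>\<psi>. interval_diffeo r \<phi> \<psi> 0 1 0 1"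
    by (intro exI)
next
  assume "\<exists>\<psi>. interval_diffeo r \<phi> \<psi> 0 1 0 1"
  then obtain \<psi> where "interval_diffeo r \<phi> \<psi> 0 1 0 1" ..
  note D = interval_diffeoD[OF this]
  have bij: "bij_betw \<phi> {0..1} {0..1}"
    using D by (intro bij_betw_byWitness[where f' = \<psi>]) auto
  have "inv_into {0..1} \<phi> s = \<psi> s" if "s \<in> {0..1}" for s
    using D(5,6)[OF that] bij by (metis bij_betw_inv_into_left)
  then have "piecewise_on (real_Cr_curve r) (inv_into {0..1} \<phi>) 0 1"
    by (rule piecewise_on_cong[OF affinely_stable_Cr_curve D(10)])
  then show "reparametrization r \<phi>"
    using bij D by (simp add: reparametrization_def piecewise_iff_piecewise_on)
qed

section \<open>Segments of paths\<close>

text \<open>The case b < a is allowed and gives a part of the path run backwards, so the inverse of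
  a segment is again a segment.\<close>

definition segment :: "(real \<Rightarrow> 'm) \<Rightarrow> real \<Rightarrow> real \<Rightarrow> real \<Rightarrow> 'm" where
  "segment \<gamma> a b = (\<lambda>t\<in>{0..1}. \<gamma> (a + (b - a) * t))"

lemma affine_unit_interval:
  fixes a b t :: real
  assumes "t \<in> {0..1}" "a \<in> {u..v}" "b \<in> {u..v}"
  shows "a + (b - a) * t \<in> {u..v}"
  using affine_between[OF assms(1), of a "b - a" u v] assms(2,3) by simp

lemma segment_apply: "t \<in> {0..1} \<Longrightarrow> segment \<gamma> a b t = \<gamma> (a + (b - a) * t)"
  by (simp add: segment_def)

lemma segment_eqI:
  "(\<And>t. t \<in> {0..1} \<Longrightarrow> \<gamma> (a + (b - a) * t) = \<delta> (c + (d - c) * t)) \<Longrightarrow> segment \<gamma> a b = segment \<delta> c d"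
  unfolding segment_def by (rule restrict_ext)

lemma segment_0_1: "\<gamma> \<in> extensional {0..1} \<Longrightarrow> segment \<gamma> 0 1 = \<gamma>"
  by (simp add: segment_def extensional_restrict)

lemma path_inv_segment: "path_inv (segment \<gamma> a b) = segment \<gamma> b a"
  by (auto simp: path_inv_def segment_def restrict_def fun_eq_iff algebra_simps)

lemma segment_path_inv:
  assumes "a \<in> {0..1}" "b \<in> {0..1}"
  shows "segment (path_inv \<gamma>) a b = segment \<gamma> (1 - a) (1 - b)"
proof (rule segment_eqI)
  fix t :: real assume "t \<in> {0..1}"
  from affine_unit_interval[OF this assms]
  show "path_inv \<gamma> (a + (b - a) * t) = \<gamma> (1 - a + (1 - b - (1 - a)) * t)"
    by (simp add: path_inv_def algebra_simps)
qed

lemma path_mult_left: "t \<in> {0..1} \<Longrightarrow> path_mult \<gamma>1 \<gamma>2 (t / 2) = \<gamma>1 t"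
  by (simp add: path_mult_def)

text \<open>At t = 0 the argument 1/2 falls into the first branch of \<open>path_mult\<close>;
  composability makes the two values agree.\<close>

lemma path_mult_right:
  assumes "composable \<gamma>1 \<gamma>2" "t \<in> {0..1}"
  shows "path_mult \<gamma>1 \<gamma>2 ((1 + t) / 2) = \<gamma>2 t"
  using assms by (cases "t = 0") (auto simp: path_mult_def composable_def add_divide_distrib)

lemma segment_path_mult_left:
  assumes "a \<in> {0..1}" "b \<in> {0..1}"
  shows "segment (path_mult \<gamma>1 \<gamma>2) (a / 2) (b / 2) = segment \<gamma>1 a b"
proof (rule segment_eqI)
  fix t :: real assume "t \<in> {0..1}"
  then have "path_mult \<gamma>1 \<gamma>2 ((a + (b - a) * t) / 2) = \<gamma>1 (a + (b - a) * t)"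
    by (intro path_mult_left affine_unit_interval assms)
  moreover have "a / 2 + (b / 2 - a / 2) * t = (a + (b - a) * t) / 2"
    by (simp add: field_simps)
  ultimately show "path_mult \<gamma>1 \<gamma>2 (a / 2 + (b / 2 - a / 2) * t) = \<gamma>1 (a + (b - a) * t)"
    by (simp only:)
qed

lemma segment_path_mult_right:
  assumes "composable \<gamma>1 \<gamma>2" "a \<in> {0..1}" "b \<in> {0..1}"
  shows "segment (path_mult \<gamma>1 \<gamma>2) ((1 + a) / 2) ((1 + b) / 2) = segment \<gamma>2 a b"
proof (rule segment_eqI)
  fix t :: real assume "t \<in> {0..1}"
  then have "path_mult \<gamma>1 \<gamma>2 ((1 + (a + (b - a) * t)) / 2) = \<gamma>2 (a + (b - a) * t)"
    by (intro path_mult_right affine_unit_interval assms)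
  moreover have "(1 + a) / 2 + ((1 + b) / 2 - (1 + a) / 2) * t = (1 + (a + (b - a) * t)) / 2"
    by (simp add: field_simps)
  ultimately show
    "path_mult \<gamma>1 \<gamma>2 ((1 + a) / 2 + ((1 + b) / 2 - (1 + a) / 2) * t) = \<gamma>2 (a + (b - a) * t)"
    by (simp only:)
qed

text \<open>This is an equality of maps, not only up to the parametrization. Hence the two halves
  decompose whatever coincides with \<gamma>, without transitivity of
  \<open>coincide\<close>.\<close>

lemma path_mult_segments:
  assumes "\<gamma> \<in> extensional {0..1}"
  shows "path_mult (segment \<gamma> 0 (1 / 2)) (segment \<gamma> (1 / 2) 1) = \<gamma>"
  using assms by (auto simp: path_mult_def segment_def extensional_def fun_eq_iff field_simps)

lemma composable_segments: "composable (segment \<gamma> a b) (segment \<gamma> b c)"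
  by (simp add: composable_def segment_def)

section \<open>Paths up to the parametrization\<close>

lemma coincide_iff:
  "coincide r \<gamma>1 \<gamma>2 \<longleftrightarrow>
     (\<exists>\<phi> \<psi>. interval_diffeo r \<phi> \<psi> 0 1 0 1 \<and> (\<forall>t\<in>{0..1}. \<gamma>1 t = \<gamma>2 (\<phi> t)))"
  unfolding coincide_def reparametrization_iff by auto

lemma coincide_refl: "coincide r \<gamma> \<gamma>"
  unfolding coincide_iff using interval_diffeo_id by blast

lemma coincide_sym: "coincide r \<gamma>1 \<gamma>2 \<Longrightarrow> coincide r \<gamma>2 \<gamma>1"
  unfolding coincide_iff using interval_diffeo_sym interval_diffeoD(5,6) by metis

lemma coincide_endpoints:
  assumes "coincide r \<gamma>1 \<gamma>2"
  shows "\<gamma>1 0 = \<gamma>2 0" "\<gamma>1 1 = \<gamma>2 1"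
  using assms interval_diffeo_endpoints unfolding coincide_iff by fastforce+

lemma coincide_segments:
  assumes "interval_diffeo r \<phi> \<psi> a b c d" "\<And>t. t \<in> {a..b} \<Longrightarrow> \<gamma>1 t = \<gamma>2 (\<phi> t)"
  shows "coincide r (segment \<gamma>1 a b) (segment \<gamma>2 c d)"
proof -
  note D = interval_diffeoD[OF assms(1)]
  let ?\<phi> = "\<lambda>t. \<phi> (a + (b - a) * t)" and ?\<psi> = "\<lambda>s. (\<psi> s - a) / (b - a)"
  \<comment> \<open>The source interval is normalized to {0..1} first, then the target.\<close>
  have "interval_diffeo r ?\<phi> ?\<psi> 0 1 c d"
    using D(1) by (intro interval_diffeo_affine[OF assms(1), where q = a and m = "b - a"]) auto
  then have diffeo: "interval_diffeo r (\<lambda>t. (?\<phi> t - c) / (d - c)) (\<lambda>s. ?\<psi> (c + (d - c) * s)) 0 1 0 1"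
    by (rule interval_diffeo_affine_image[where q = c and m = "d - c"]) (use D(2) in auto)
  have "segment \<gamma>1 a b t = segment \<gamma>2 c d ((?\<phi> t - c) / (d - c))" if "t \<in> {0..1}" for t
    using that interval_diffeoD(3)[OF diffeo that] assms(2)[OF affine_unit_interval[OF that]] D(1,2)
    by (simp add: segment_def)
  then show ?thesis unfolding coincide_iff using diffeo by blast
qed

text \<open>Converse to \<open>coincide_segments\<close>. The interval {l..u} is the place that
  \<alpha> occupies as a factor of a product, that is, one of the halves of {0..1}.\<close>

lemma coincide_segment_diffeo:
  assumes "coincide r \<alpha> (segment \<gamma> a b)" "a < b" "l < u"
  obtains \<phi> \<psi> where "interval_diffeo r \<phi> \<psi> l u a b"
    "\<And>t. t \<in> {l..u} \<Longrightarrow> \<alpha> ((t - l) / (u - l)) = \<gamma> (\<phi> t)"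
proof -
  obtain \<phi> \<psi> where diffeo: "interval_diffeo r \<phi> \<psi> 0 1 0 1"
    and eq: "\<And>t. t \<in> {0..1} \<Longrightarrow> \<alpha> t = segment \<gamma> a b (\<phi> t)"
    using assms(1) unfolding coincide_iff by blast
  define \<phi>1 where "\<phi>1 = (\<lambda>t. \<phi> ((t - l) / (u - l)))"
  define \<psi>1 where "\<psi>1 = (\<lambda>s. l + (u - l) * \<psi> s)"
  have scale: "- x / (y - x) + 1 / (y - x) * t = (t - x) / (y - x)" for x y t :: real
    by (simp add: diff_divide_distrib)
  have unscale: "(t - - x / (y - x)) / (1 / (y - x)) = x + (y - x) * t" if "x < y" for x y t :: real
    using that by (simp add: distrib_left mult.commute)
  have "interval_diffeo r \<phi>1 \<psi>1 l u 0 1"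
    using assms(3)
    by (intro interval_diffeo_affine[OF diffeo, where q = "- l / (u - l)" and m = "1 / (u - l)"])
      (simp_all only: scale unscale \<phi>1_def \<psi>1_def, simp_all)
  then have "interval_diffeo r (\<lambda>t. a + (b - a) * \<phi>1 t) (\<lambda>s. \<psi>1 ((s - a) / (b - a))) l u a b"
    using assms(2)
    by (elim interval_diffeo_affine_image[where q = "- a / (b - a)" and m = "1 / (b - a)"])
      (simp_all only: scale unscale, simp_all)
  moreover have "\<alpha> ((t - l) / (u - l)) = \<gamma> (a + (b - a) * \<phi>1 t)" if "t \<in> {l..u}" for t
  proof -
    have "(t - l) / (u - l) \<in> {0..1}" using that assms(3) by (auto simp: field_simps)
    then show ?thesis
      using eq interval_diffeoD(3)[OF diffeo] by (simp add: segment_def \<phi>1_def)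
  qed
  ultimately show ?thesis using that by blast
qed

text \<open>The reparametrizations of the two factors are moved to the halves of {0..1} and glued;
  the glued map sends 1/2 to b.\<close>

lemma coincide_path_mult_segment:
  assumes "coincide r \<alpha> (segment \<gamma> a b)" "coincide r \<beta> (segment \<gamma> b c)" "a < b" "b < c"
  shows "coincide r (path_mult \<alpha> \<beta>) (segment \<gamma> a c)"
proof -
  obtain \<phi>1 \<psi>1 where 1: "interval_diffeo r \<phi>1 \<psi>1 0 (1 / 2) a b"
    "\<And>t. t \<in> {0..1 / 2} \<Longrightarrow> \<alpha> ((t - 0) / (1 / 2 - 0)) = \<gamma> (\<phi>1 t)"
    using coincide_segment_diffeo[OF assms(1,3), of 0 "1 / 2"] by auto
  obtain \<phi>2 \<psi>2 where 2: "interval_diffeo r \<phi>2 \<psi>2 (1 / 2) 1 b c"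
    "\<And>t. t \<in> {1 / 2..1} \<Longrightarrow> \<beta> ((t - 1 / 2) / (1 - 1 / 2)) = \<gamma> (\<phi>2 t)"
    using coincide_segment_diffeo[OF assms(2,4), of "1 / 2" 1] by auto
  have "coincide r (segment (path_mult \<alpha> \<beta>) 0 1) (segment \<gamma> a c)"
    using interval_diffeo_join[OF 1(1) 2(1)]
  proof (rule coincide_segments)
    fix t :: real assume "t \<in> {0..1}"
    then show "path_mult \<alpha> \<beta> t = \<gamma> (if t \<le> 1 / 2 then \<phi>1 t else \<phi>2 t)"
      using 1(2)[of t] 2(2)[of t] by (auto simp: path_mult_def diff_divide_distrib mult.commute)
  qed
  then show ?thesis by (simp add: segment_0_1 path_mult_def)
qed

section \<open>Finite paths\<close>

text \<open>Local counterpart of the edges and trivial paths in the definition of finiteness; being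
  a condition on single intervals, it passes to segments and products.\<close>

definition simple_or_const :: "real set \<Rightarrow> (real \<Rightarrow> 'm) \<Rightarrow> bool" where
  "simple_or_const J \<gamma> \<longleftrightarrow> inj_on \<gamma> J \<or> (\<exists>p. \<forall>t\<in>J. \<gamma> t = p)"

lemma affinely_stable_simple_or_const: "affinely_stable simple_or_const"
  unfolding affinely_stable_def simple_or_const_def
proof (intro allI impI, elim conjE disjE)
  fix a b c d q m and f g :: "real \<Rightarrow> 'm"
  assume m: "m \<noteq> 0" and *: "\<forall>t\<in>{c..d}. q + m * t \<in> {a..b} \<and> g t = f (q + m * t)"
  {
    assume "inj_on f {a..b}"
    have "inj_on g {c..d}"
    proof (rule inj_onI)
      fix s t assume "s \<in> {c..d}" "t \<in> {c..d}" "g s = g t"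
      then have "q + m * s = q + m * t"
        using * by (intro inj_onD[OF \<open>inj_on f {a..b}\<close>]) auto
      then show "s = t" using m by simp
    qed
    then show "inj_on g {c..d} \<or> (\<exists>p. \<forall>t\<in>{c..d}. g t = p)" ..
  }
  {
    assume "\<exists>p. \<forall>t\<in>{a..b}. f t = p"
    then show "inj_on g {c..d} \<or> (\<exists>p. \<forall>t\<in>{c..d}. g t = p)" using * by auto
  }
qed

lemma piecewise_on_path_mult:
  assumes P: "affinely_stable P" and "piecewise_on P \<alpha> 0 1" "piecewise_on P \<beta> 0 1" "composable \<alpha> \<beta>"
  shows "piecewise_on P (path_mult \<alpha> \<beta>) 0 1"
proof (rule piecewise_on_trans)
  show "piecewise_on P (path_mult \<alpha> \<beta>) 0 (1 / 2)"
    by (rule piecewise_on_affine[OF P assms(2), where q = 0 and m = 2])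
      (auto simp: path_mult_def)
  show "piecewise_on P (path_mult \<alpha> \<beta>) (1 / 2) 1"
  proof (rule piecewise_on_affine[OF P assms(3), where q = "- 1" and m = 2])
    fix t :: real assume "t \<in> {1 / 2..1}"
    then show "path_mult \<alpha> \<beta> t = \<beta> (- 1 + 2 * t)"
      using path_mult_right[OF assms(4), of "- 1 + 2 * t"] by simp
  qed auto
qed

lemma path_mult_0: "path_mult \<alpha> \<beta> 0 = \<alpha> 0"
  by (simp add: path_mult_def)

lemma path_mult_1: "path_mult \<alpha> \<beta> 1 = \<beta> 1"
  by (simp add: path_mult_def)

lemma path_prod_Cons: "\<gamma>s \<noteq> [] \<Longrightarrow> path_prod (\<gamma> # \<gamma>s) = path_mult \<gamma> (path_prod \<gamma>s)"
  by (cases \<gamma>s) auto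

lemma path_prod_0: "\<gamma>s \<noteq> [] \<Longrightarrow> path_prod \<gamma>s 0 = hd \<gamma>s 0"
  by (cases \<gamma>s rule: path_prod.cases) (auto simp: path_mult_0)

lemma path_prod_1: "\<gamma>s \<noteq> [] \<Longrightarrow> path_prod \<gamma>s 1 = last \<gamma>s 1"
  by (induction \<gamma>s rule: path_prod.induct) (auto simp: path_mult_1)

lemma composable_path_prod:
  "successively composable (\<gamma> # \<gamma>s) \<Longrightarrow> \<gamma>s \<noteq> [] \<Longrightarrow> composable \<gamma> (path_prod \<gamma>s)"
  by (cases \<gamma>s) (auto simp: composable_def path_prod_0)

text \<open>An edge may be closed, so it is injective only on each half of the interval.\<close>

lemma piecewise_on_simple_edge_or_trivial:
  assumes "is_edge e \<or> trivial_path e"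
  shows "piecewise_on simple_or_const e 0 1"
  using assms
proof
  assume e: "is_edge e"
  have half: "simple_or_const {a..b} e" if "0 \<le> a" "b \<le> 1" "b - a < 1" for a b
    unfolding simple_or_const_def
  proof (intro disjI1 inj_onI)
    fix s t assume *: "s \<in> {a..b}" "t \<in> {a..b}" "e s = e t"
    then have "\<bar>s - t\<bar> \<in> {0, 1}" using e that unfolding is_edge_def by auto
    moreover have "\<bar>s - t\<bar> < 1" using * that by auto
    ultimately show "s = t" by auto
  qed
  show ?thesis
    by (rule piecewise_on.step[of 0 "1 / 2"], simp, rule half, simp_all)
      (rule piecewise_on.single, simp, rule half, simp_all)
next
  assume "trivial_path e"
  then show ?thesis
    by (intro piecewise_on.single) (auto simp: trivial_path_def simple_or_const_def)
qed

lemma edge_or_trivial_segment: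
  assumes "simple_or_const {a..b} \<gamma>" "a < b"
  shows "is_edge (segment \<gamma> a b) \<or> trivial_path (segment \<gamma> a b)"
proof -
  have im: "a + (b - a) * t \<in> {a..b}" if "t \<in> {0..1}" for t
    using affine_unit_interval[OF that, of a a b b] assms(2) by simp
  from assms(1) show ?thesis
    unfolding simple_or_const_def
  proof
    assume inj: "inj_on \<gamma> {a..b}"
    have "s = t" if "s \<in> {0..1}" "t \<in> {0..1}" "segment \<gamma> a b s = segment \<gamma> a b t" for s t
      using inj_onD[OF inj _ im[OF that(1)] im[OF that(2)]] that assms(2)
      by (simp add: segment_apply)
    then show ?thesis unfolding is_edge_def by auto
  next
    assume "\<exists>p. \<forall>t\<in>{a..b}. \<gamma> t = p"
    then obtain p where "\<And>t. t \<in> {a..b} \<Longrightarrow> \<gamma> t = p" by blast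
    then have "segment \<gamma> a b t = p" if "t \<in> {0..1}" for t
      using im[OF that] that by (simp add: segment_apply)
    then have "segment \<gamma> a b ` {0..1} = {p}" by (auto intro!: image_eqI[of _ _ 0])
    then show ?thesis unfolding trivial_path_def by blast
  qed
qed

lemma prepaths_iff:
  "\<gamma> \<in> prepaths r k X A \<longleftrightarrow> \<gamma> \<in> {0..1} \<rightarrow>\<^sub>E topspace X \<and> piecewise_on (piece r k X A) \<gamma> 0 1"
  by (simp add: prepaths_def piecewise_iff_piecewise_on)

section \<open>Closure of the set of paths under segments, inverses and products\<close>

locale path_space =
  fixes r :: regularity and k :: path_kind and X :: "'m topology"
    and A :: "('m, 'e::real_normed_vector) chart set"
  assumes regular: "r \<noteq> C_fin 0"
begin

abbreviation "\<P> \<equiv> paths r k X A"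

lemma piecewise_on_segment:
  assumes "affinely_stable P" "piecewise_on P \<gamma> 0 1" "a \<in> {0..1}" "b \<in> {0..1}" "a \<noteq> b"
  shows "piecewise_on P (segment \<gamma> a b) 0 1"
  using assms(3-5)
  by (intro piecewise_on_affine[OF assms(1,2), where q = a and m = "b - a"])
    (auto simp: segment_apply)

lemma segment_in_PiE:
  assumes "\<gamma> \<in> {0..1} \<rightarrow>\<^sub>E topspace X" "a \<in> {0..1}" "b \<in> {0..1}"
  shows "segment \<gamma> a b \<in> {0..1} \<rightarrow>\<^sub>E topspace X"
  using assms affine_unit_interval[OF _ assms(2,3)] unfolding segment_def by (auto simp: PiE_iff)

lemma segment_in_prepaths:
  "\<gamma> \<in> prepaths r k X A \<Longrightarrow> a \<in> {0..1} \<Longrightarrow> b \<in> {0..1} \<Longrightarrow> a \<noteq> b \<Longrightarrow> segment \<gamma> a b \<in> prepaths r k X A"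
  by (simp add: prepaths_iff segment_in_PiE piecewise_on_segment[OF affinely_stable_piece[OF regular]])

text \<open>The segments over the pieces are themselves the factors; their product is matched with
  the whole segment by gluing from the right.\<close>

lemma finite_segment:
  assumes "piecewise_on simple_or_const \<gamma> a b" "\<gamma> \<in> prepaths r k X A" "0 \<le> a" "b \<le> 1"
  shows "\<exists>es. es \<noteq> [] \<and> set es \<subseteq> prepaths r k X A \<and> (\<forall>e\<in>set es. is_edge e \<or> trivial_path e) \<and>
    successively composable es \<and> coincide r (path_prod es) (segment \<gamma> a b)"
  using assms
proof (induction rule: piecewise_on.induct)
  case (single a b)
  then show ?case
    using edge_or_trivial_segment[OF single.hyps(2,1)] coincide_refl
    by (intro exI[of _ "[segment \<gamma> a b]"]) (auto intro!: segment_in_prepaths)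
next
  case (step a b c)
  have "b < c" using piecewise_on_less[OF step.hyps(3)] .
  obtain es where es: "es \<noteq> []" "set es \<subseteq> prepaths r k X A" "\<forall>e\<in>set es. is_edge e \<or> trivial_path e"
    "successively composable es" "coincide r (path_prod es) (segment \<gamma> b c)"
    using step by auto
  have "segment \<gamma> a b \<in> prepaths r k X A"
    using step.prems step.hyps(1) \<open>b < c\<close> by (intro segment_in_prepaths) auto
  moreover have "successively composable (segment \<gamma> a b # es)"
    using es(1,4) coincide_endpoints(1)[OF es(5)] path_prod_0[OF es(1)]
    by (cases es) (auto simp: composable_def segment_def)
  moreover have "coincide r (path_prod (segment \<gamma> a b # es)) (segment \<gamma> a c)"
    unfolding path_prod_Cons[OF es(1)]
    using coincide_refl es(5) step.hyps(1) \<open>b < c\<close> by (rule coincide_path_mult_segment)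
  ultimately show ?case
    using es edge_or_trivial_segment[OF step.hyps(2,1)]
    by (intro exI[of _ "segment \<gamma> a b # es"]) auto
qed

text \<open>Replaces finiteness by a piecewise condition, from which closure under segments and
  products can be read off. Forwards, a partition adapted to the product of edges is carried to
  \<gamma> by the inverse reparametrization; backwards, \<open>finite_segment\<close> is applied to
  the whole interval.\<close>

lemma paths_iff:
  "\<gamma> \<in> \<P> \<longleftrightarrow> \<gamma> \<in> {0..1} \<rightarrow>\<^sub>E topspace X \<and> piecewise_on (piece r k X A) \<gamma> 0 1 \<and>
     piecewise_on simple_or_const \<gamma> 0 1"
proof
  assume "\<gamma> \<in> \<P>"
  then obtain es where \<gamma>: "\<gamma> \<in> prepaths r k X A" and es: "es \<noteq> []"
    "\<forall>e\<in>set es. is_edge e \<or> trivial_path e" "successively composable es" "coincide r \<gamma> (path_prod es)"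
    unfolding paths_def by blast
  have prod: "piecewise_on simple_or_const (path_prod es) 0 1"
    using es(1-3)
  proof (induction es)
    case (Cons e es)
    show ?case
    proof (cases "es = []")
      case False
      then have "piecewise_on simple_or_const (path_prod es) 0 1"
        using Cons by (auto simp: successively_Cons)
      then show ?thesis
        unfolding path_prod_Cons[OF False] using Cons.prems False
        by (intro piecewise_on_path_mult[OF affinely_stable_simple_or_const
            piecewise_on_simple_edge_or_trivial] composable_path_prod) auto
    qed (use Cons in \<open>simp add: piecewise_on_simple_edge_or_trivial\<close>)
  qed simp
  obtain \<phi> \<psi> where diffeo: "interval_diffeo r \<phi> \<psi> 0 1 0 1"
    and eq: "\<And>t. t \<in> {0..1} \<Longrightarrow> \<gamma> t = path_prod es (\<phi> t)"
    using es(4) unfolding coincide_iff by blast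
  note D = interval_diffeoD[OF diffeo]
  have "piecewise_on simple_or_const \<gamma> (\<psi> 0) (\<psi> 1)"
  proof (rule piecewise_on_map[OF prod D(8)])
    fix c d :: real assume cd: "0 \<le> c" "c < d" "d \<le> 1" and sc: "simple_or_const {c..d} (path_prod es)"
    have sub: "{\<psi> c..\<psi> d} \<subseteq> {0..1}"
      using D(5)[of c] D(5)[of d] cd by auto
    \<comment> \<open>By monotonicity \<phi> leads from the transported piece back into the original
      one, where the product is injective or constant.\<close>
    have im: "\<phi> t \<in> {c..d}" if "t \<in> {\<psi> c..\<psi> d}" for t
      using strict_mono_on_leD[OF D(7), of "\<psi> c" t] strict_mono_on_leD[OF D(7), of t "\<psi> d"]
        that sub D(6)[of c] D(6)[of d] D(5)[of c] D(5)[of d] cd by auto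
    from sc show "simple_or_const {\<psi> c..\<psi> d} \<gamma>"
      unfolding simple_or_const_def
    proof
      assume inj: "inj_on (path_prod es) {c..d}"
      have "inj_on \<gamma> {\<psi> c..\<psi> d}"
      proof (rule inj_onI)
        fix s t assume st: "s \<in> {\<psi> c..\<psi> d}" "t \<in> {\<psi> c..\<psi> d}" "\<gamma> s = \<gamma> t"
        then have unit: "s \<in> {0..1}" "t \<in> {0..1}" using sub by blast+
        have "\<phi> s = \<phi> t"
          using st(3) unfolding eq[OF unit(1)] eq[OF unit(2)]
          by (rule inj_onD[OF inj _ im[OF st(1)] im[OF st(2)]])
        then show "s = t" using D(4)[OF unit(1)] D(4)[OF unit(2)] by metis
      qed
      then show "inj_on \<gamma> {\<psi> c..\<psi> d} \<or> (\<exists>p. \<forall>t\<in>{\<psi> c..\<psi> d}. \<gamma> t = p)" ..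
    next
      assume "\<exists>p. \<forall>t\<in>{c..d}. path_prod es t = p"
      then obtain p where p: "\<And>t. t \<in> {c..d} \<Longrightarrow> path_prod es t = p" by blast
      have "\<gamma> t = p" if "t \<in> {\<psi> c..\<psi> d}" for t
        using eq p[OF im[OF that]] that sub by (metis subsetD)
      then show "inj_on \<gamma> {\<psi> c..\<psi> d} \<or> (\<exists>p. \<forall>t\<in>{\<psi> c..\<psi> d}. \<gamma> t = p)" by blast
    qed
  qed
  then have "piecewise_on simple_or_const \<gamma> 0 1"
    using interval_diffeo_endpoints[OF interval_diffeo_sym[OF diffeo]] by simp
  then show "\<gamma> \<in> {0..1} \<rightarrow>\<^sub>E topspace X \<and> piecewise_on (piece r k X A) \<gamma> 0 1 \<and>
     piecewise_on simple_or_const \<gamma> 0 1"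
    using \<gamma> by (simp add: prepaths_iff)
next
  assume \<gamma>: "\<gamma> \<in> {0..1} \<rightarrow>\<^sub>E topspace X \<and> piecewise_on (piece r k X A) \<gamma> 0 1 \<and>
     piecewise_on simple_or_const \<gamma> 0 1"
  then have pre: "\<gamma> \<in> prepaths r k X A" and eq: "segment \<gamma> 0 1 = \<gamma>"
    by (simp_all add: prepaths_iff PiE_iff segment_0_1)
  obtain es where "es \<noteq> []" "set es \<subseteq> prepaths r k X A" "\<forall>e\<in>set es. is_edge e \<or> trivial_path e"
    "successively composable es" "coincide r (path_prod es) \<gamma>"
    using finite_segment[of \<gamma> 0 1] \<gamma> pre unfolding eq by auto
  with coincide_sym[OF this(5)] pre show "\<gamma> \<in> \<P>"
    unfolding paths_def by blast
qed

lemma paths_extensional: "\<gamma> \<in> \<P> \<Longrightarrow> \<gamma> \<in> extensional {0..1}"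
  by (simp add: paths_iff PiE_iff)

lemma segment_in_paths:
  "\<gamma> \<in> \<P> \<Longrightarrow> a \<in> {0..1} \<Longrightarrow> b \<in> {0..1} \<Longrightarrow> a \<noteq> b \<Longrightarrow> segment \<gamma> a b \<in> \<P>"
  by (simp add: paths_iff segment_in_PiE piecewise_on_segment[OF affinely_stable_piece[OF regular]]
      piecewise_on_segment[OF affinely_stable_simple_or_const])

lemma path_inv_in_paths: "\<gamma> \<in> \<P> \<Longrightarrow> path_inv \<gamma> \<in> \<P>"
  using segment_in_paths[of \<gamma> 1 0] path_inv_segment[of \<gamma> 0 1]
  by (simp add: segment_0_1 paths_extensional)

lemma path_mult_in_paths:
  assumes "\<gamma>1 \<in> \<P>" "\<gamma>2 \<in> \<P>" "composable \<gamma>1 \<gamma>2"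
  shows "path_mult \<gamma>1 \<gamma>2 \<in> \<P>"
proof -
  have "path_mult \<gamma>1 \<gamma>2 \<in> {0..1} \<rightarrow>\<^sub>E topspace X"
    using assms(1,2) unfolding paths_iff by (auto simp: path_mult_def PiE_iff)
  then show ?thesis
    using assms
    by (simp add: paths_iff piecewise_on_path_mult[OF affinely_stable_piece[OF regular]]
        piecewise_on_path_mult[OF affinely_stable_simple_or_const])
qed

lemma path_prod_in_paths:
  "\<gamma>s \<noteq> [] \<Longrightarrow> set \<gamma>s \<subseteq> \<P> \<Longrightarrow> successively composable \<gamma>s \<Longrightarrow> path_prod \<gamma>s \<in> \<P>"
proof (induction \<gamma>s)
  case (Cons \<gamma> \<gamma>s)
  show ?case
  proof (cases "\<gamma>s = []")
    case False
    then have "path_prod \<gamma>s \<in> \<P>"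
      using Cons by (auto simp: successively_Cons)
    then show ?thesis
      unfolding path_prod_Cons[OF False] using Cons.prems False
      by (intro path_mult_in_paths composable_path_prod) auto
  qed (use Cons in simp)
qed simp

lemma hereditary_paths: "hereditary r k X A \<P>"
  by (auto simp: hereditary_def decomposition_def path_inv_in_paths)

lemma decomposition_single: "decomposition r k X A [\<gamma>] \<gamma>' \<longleftrightarrow> \<gamma> \<in> \<P> \<and> coincide r \<gamma> \<gamma>'"
  by (simp add: decomposition_def)

lemma decomposition_pair:
  "decomposition r k X A [\<gamma>1, \<gamma>2] \<gamma> \<longleftrightarrow>
     \<gamma>1 \<in> \<P> \<and> \<gamma>2 \<in> \<P> \<and> composable \<gamma>1 \<gamma>2 \<and> coincide r (path_mult \<gamma>1 \<gamma>2) \<gamma>"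
  by (auto simp: decomposition_def)

lemma decomposition_segments:
  assumes "\<gamma> \<in> \<P>" "0 \<le> a" "a < b" "b < c" "c \<le> 1"
  shows "decomposition r k X A [segment \<gamma> a b, segment \<gamma> b c] (segment \<gamma> a c)"
  unfolding decomposition_pair using assms
  by (intro conjI segment_in_paths composable_segments
      coincide_path_mult_segment[OF coincide_refl coincide_refl]) auto

end

section \<open>Germs\<close>

context path_space
begin

lemma germD:
  assumes "germ r k X A G Q \<rho>" "\<gamma> \<in> Q"
  shows "\<gamma> \<in> \<P>" "\<rho> \<gamma> \<in> carrier G" "path_inv \<gamma> \<in> Q" "\<rho> (path_inv \<gamma>) = inv\<^bsub>G\<^esub> \<rho> \<gamma>"
    "decomposition r k X A \<gamma>s \<gamma> \<Longrightarrow> set \<gamma>s \<subseteq> Q"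
    "decomposition r k X A [\<gamma>1, \<gamma>2] \<gamma> \<Longrightarrow> \<rho> \<gamma> = \<rho> \<gamma>1 \<otimes>\<^bsub>G\<^esub> \<rho> \<gamma>2"
  using assms unfolding germ_def hereditary_def by blast+

text \<open>The two halves of a path also decompose every reparametrization of it.\<close>

lemma germ_coincide:
  assumes \<rho>: "germ r k X A G Q \<rho>" and "\<gamma> \<in> Q" "\<gamma>' \<in> Q" "coincide r \<gamma> \<gamma>'"
  shows "\<rho> \<gamma> = \<rho> \<gamma>'"
proof -
  let ?\<alpha> = "segment \<gamma> 0 (1 / 2)" and ?\<beta> = "segment \<gamma> (1 / 2) 1"
  have "\<gamma> \<in> \<P>" using germD(1)[OF \<rho> \<open>\<gamma> \<in> Q\<close>] .
  then have "decomposition r k X A [?\<alpha>, ?\<beta>] \<delta>" if "coincide r \<gamma> \<delta>" for \<delta>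
    using that path_mult_segments[OF paths_extensional]
    by (simp add: decomposition_pair segment_in_paths composable_segments)
  from this[OF coincide_refl] this[OF assms(4)] show ?thesis
    using germD(6)[OF \<rho>] assms(2,3) by metis
qed

lemma germ_path_mult:
  assumes "germ r k X A G \<P> \<rho>" "\<gamma>1 \<in> \<P>" "\<gamma>2 \<in> \<P>" "composable \<gamma>1 \<gamma>2"
  shows "\<rho> (path_mult \<gamma>1 \<gamma>2) = \<rho> \<gamma>1 \<otimes>\<^bsub>G\<^esub> \<rho> \<gamma>2"
  using assms
  by (intro germD(6)[OF assms(1) path_mult_in_paths]) (simp_all add: decomposition_pair coincide_refl)

section \<open>Invariants of path equivalence\<close>

lemma insert_retracing_endpoints:
  assumes "insert_retracing P \<gamma> \<gamma>'"
  shows "\<gamma> 0 = \<gamma>' 0" "\<gamma> 1 = \<gamma>' 1"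
proof -
  obtain as \<delta> bs where *: "as @ bs \<noteq> []" "successively composable (as @ [\<delta>, path_inv \<delta>] @ bs)"
    "\<gamma> = path_prod (as @ bs)" "\<gamma>' = path_prod (as @ [\<delta>, path_inv \<delta>] @ bs)"
    using assms unfolding insert_retracing_def by blast
  have start: "\<gamma> 0 = hd (as @ bs) 0" "\<gamma>' 0 = hd (as @ [\<delta>, path_inv \<delta>] @ bs) 0"
    unfolding *(3,4) by (rule path_prod_0, use *(1) in simp)+
  have final: "\<gamma> 1 = last (as @ bs) 1" "\<gamma>' 1 = last (as @ [\<delta>, path_inv \<delta>] @ bs) 1"
    unfolding *(3,4) by (rule path_prod_1, use *(1) in simp)+
  show "\<gamma> 0 = \<gamma>' 0"
    \<comment> \<open>The delicate case is as = []: then \<gamma>' starts with \<delta>, and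
      composability of \<open>path_inv \<delta>\<close> with the first factor of bs says that
      \<delta> starts where \<gamma> does. The end point is symmetric, with bs = [].\<close>
    unfolding start using *(1,2) by (cases as; cases bs) (auto simp: composable_def path_inv_def)
  show "\<gamma> 1 = \<gamma>' 1"
    unfolding final using *(1,2)
    by (cases as rule: rev_cases; cases bs rule: rev_cases)
      (auto simp: composable_def path_inv_def successively_append_iff)
qed

text \<open>Stated for an arbitrary f because it is applied both to the end points and to
  germs.\<close>

lemma path_equiv_invariant:
  assumes "(\<gamma>, \<gamma>') \<in> path_equiv r k X A"
    "\<And>\<alpha> \<beta>. \<alpha> \<in> \<P> \<Longrightarrow> \<beta> \<in> \<P> \<Longrightarrow> coincide r \<alpha> \<beta> \<or> insert_retracing \<P> \<alpha> \<beta> \<Longrightarrow> f \<alpha> = f \<beta>"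
  shows "f \<gamma> = f \<gamma>'"
proof -
  have "equivclp (elementary_step r \<P>) \<gamma> \<gamma>'"
    using assms(1) by (simp add: path_equiv_def)
  then show ?thesis
    by (induction rule: equivclp_induct) (use assms(2) in \<open>auto simp: elementary_step_def\<close>)
qed

lemma path_equiv_endpoints:
  assumes "(\<gamma>, \<gamma>') \<in> path_equiv r k X A"
  shows "\<gamma> 0 = \<gamma>' 0" "\<gamma> 1 = \<gamma>' 1"
proof -
  show "\<gamma> 0 = \<gamma>' 0"
    by (rule path_equiv_invariant[OF assms, where f = "\<lambda>\<gamma>. \<gamma> 0"])
      (metis coincide_endpoints(1) insert_retracing_endpoints(1))
  show "\<gamma> 1 = \<gamma>' 1"
    by (rule path_equiv_invariant[OF assms, where f = "\<lambda>\<gamma>. \<gamma> 1"])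
      (metis coincide_endpoints(2) insert_retracing_endpoints(2))
qed

lemma equiv_path_equiv: "equiv \<P> (path_equiv r k X A)"
proof (rule equivI)
  show "refl_on \<P> (path_equiv r k X A)"
    by (auto simp: refl_on_def path_equiv_def)
  show "sym (path_equiv r k X A)"
    by (auto simp: sym_def path_equiv_def intro: equivclp_sym)
  show "trans (path_equiv r k X A)"
    by (auto simp: trans_def path_equiv_def intro: equivclp_trans)
qed (auto simp: path_equiv_def)

end

section \<open>Germs on all paths and the induced homomorphism\<close>

locale path_space_group = path_space r k X A + group G
  for r k X and A :: "('m, 'e::real_normed_vector) chart set" and G (structure)
begin

lemma foldr_mult_closed:
  "set xs \<subseteq> carrier G \<Longrightarrow> foldr (\<otimes>) xs \<one> \<in> carrier G"
  by (induction xs) auto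

lemma foldr_mult_append:
  "set xs \<subseteq> carrier G \<Longrightarrow> set ys \<subseteq> carrier G \<Longrightarrow>
     foldr (\<otimes>) (xs @ ys) \<one> = foldr (\<otimes>) xs \<one> \<otimes> foldr (\<otimes>) ys \<one>"
  by (induction xs) (auto simp: m_assoc foldr_mult_closed)

lemma germ_path_prod:
  assumes \<rho>: "germ r k X A G \<P> \<rho>" and "\<gamma>s \<noteq> []" "set \<gamma>s \<subseteq> \<P>" "successively composable \<gamma>s"
  shows "\<rho> (path_prod \<gamma>s) = foldr (\<otimes>) (map \<rho> \<gamma>s) \<one>"
  using assms(2-)
proof (induction \<gamma>s)
  case (Cons \<gamma> \<gamma>s)
  show ?case
  proof (cases "\<gamma>s = []")
    case True
    then show ?thesis using Cons.prems germD(2)[OF \<rho>] by simp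
  next
    case False
    then have "set \<gamma>s \<subseteq> \<P>" "successively composable \<gamma>s" "\<gamma> \<in> \<P>"
      using Cons.prems by (auto simp: successively_Cons)
    then show ?thesis
      using Cons.IH[OF False] germ_path_mult[OF \<rho>] False Cons.prems(3)
      by (simp add: path_prod_Cons path_prod_in_paths composable_path_prod)
  qed
qed simp

lemma germ_decomposition:
  assumes \<rho>: "germ r k X A G \<P> \<rho>" and "\<gamma> \<in> \<P>" "decomposition r k X A \<gamma>s \<gamma>"
  shows "\<rho> \<gamma> = foldr (\<otimes>) (map \<rho> \<gamma>s) \<one>"
  using assms(3) germ_path_prod[OF \<rho>] germ_coincide[OF \<rho> path_prod_in_paths \<open>\<gamma> \<in> \<P>\<close>]
  unfolding decomposition_def by metis

lemma germ_insert_retracing: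
  assumes \<rho>: "germ r k X A G \<P> \<rho>" and "insert_retracing \<P> \<gamma> \<gamma>'"
  shows "\<rho> \<gamma> = \<rho> \<gamma>'"
proof -
  obtain as \<delta> bs where *: "as @ bs \<noteq> []" "set (as @ \<delta> # bs) \<subseteq> \<P>" "successively composable (as @ bs)"
    "successively composable (as @ [\<delta>, path_inv \<delta>] @ bs)"
    "\<gamma> = path_prod (as @ bs)" "\<gamma>' = path_prod (as @ [\<delta>, path_inv \<delta>] @ bs)"
    using assms(2) unfolding insert_retracing_def by blast
  have carr: "set (map \<rho> as) \<subseteq> carrier G" "set (map \<rho> bs) \<subseteq> carrier G" "\<rho> \<delta> \<in> carrier G"
    using *(2) germD(2)[OF \<rho>] by auto
  have "\<rho> \<gamma> = foldr (\<otimes>) (map \<rho> as) \<one> \<otimes> foldr (\<otimes>) (map \<rho> bs) \<one>"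
    using germ_path_prod[OF \<rho> *(1)] *(2,3,5) foldr_mult_append[OF carr(1,2)] by simp
  moreover have "\<rho> \<gamma>' = foldr (\<otimes>) (map \<rho> as) \<one> \<otimes> (\<rho> \<delta> \<otimes> (inv \<rho> \<delta> \<otimes> foldr (\<otimes>) (map \<rho> bs) \<one>))"
    using germ_path_prod[OF \<rho>, of "as @ [\<delta>, path_inv \<delta>] @ bs"] *(2,4,6) path_inv_in_paths[of \<delta>]
      foldr_mult_append[OF carr(1), of "\<rho> \<delta> # inv \<rho> \<delta> # map \<rho> bs"] carr germD(4)[OF \<rho>, of \<delta>]
    by simp
  ultimately show ?thesis
    using carr by (simp add: foldr_mult_closed flip: m_assoc)
qed

lemma germ_path_equiv:
  assumes \<rho>: "germ r k X A G \<P> \<rho>" and "(\<gamma>, \<gamma>') \<in> path_equiv r k X A"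
  shows "\<rho> \<gamma> = \<rho> \<gamma>'"
  using germ_coincide[OF \<rho>] germ_insert_retracing[OF \<rho>]
  by (intro path_equiv_invariant[OF assms(2)]) blast

lemma induced_map_eq:
  assumes "germ r k X A G \<P> \<rho>" "C \<in> path_classes r k X A" "\<gamma> \<in> C"
  shows "induced_map \<rho> C = \<rho> \<gamma>"
proof -
  have "\<rho> \<gamma>' = \<rho> \<gamma>" if "\<gamma>' \<in> C" for \<gamma>'
    using germ_path_equiv[OF assms(1)] quotient_eq_iff[OF equiv_path_equiv _ _ that assms(3)]
      assms(2) unfolding path_classes_def by blast
  then have "\<rho> ` C = {\<rho> \<gamma>}" using assms(3) by blast
  then show ?thesis by (simp add: induced_map_def)
qed

lemma path_classes_subset: "C \<in> path_classes r k X A \<Longrightarrow> C \<subseteq> \<P>"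
  using in_quotient_imp_subset[OF equiv_path_equiv] unfolding path_classes_def by blast

text \<open>\<open>class_mult\<close> is a union over all representatives. It is not identified as a
  single class; it suffices that \<rho> is constant on the union and that the union is
  nonempty.\<close>

lemma groupoid_hom_induced_map:
  assumes \<rho>: "germ r k X A G \<P> \<rho>"
  shows "groupoid_hom r k X A G (induced_map \<rho>)"
  unfolding groupoid_hom_def
proof (intro conjI ballI impI)
  show "induced_map \<rho> \<in> path_classes r k X A \<rightarrow> carrier G"
  proof
    fix C assume C: "C \<in> path_classes r k X A"
    then obtain \<gamma> where "\<gamma> \<in> C"
      using in_quotient_imp_non_empty[OF equiv_path_equiv] unfolding path_classes_def by blast
    then show "induced_map \<rho> C \<in> carrier G"
      using induced_map_eq[OF \<rho> C] germD(2)[OF \<rho>] path_classes_subset[OF C] by auto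
  qed
next
  fix C D
  assume C: "C \<in> path_classes r k X A" and D: "D \<in> path_classes r k X A" and "class_composable C D"
  then obtain \<gamma>1 \<gamma>2 where \<gamma>: "\<gamma>1 \<in> C" "\<gamma>2 \<in> D" "composable \<gamma>1 \<gamma>2"
    unfolding class_composable_def by blast
  \<comment> \<open>Equivalent paths share their end points, so one composable pair of
    representatives makes all pairs composable, and every product in the union is a path.\<close>
  have comp: "composable \<alpha> \<beta>" if "\<alpha> \<in> C" "\<beta> \<in> D" for \<alpha> \<beta>
  proof -
    have "(\<alpha>, \<gamma>1) \<in> path_equiv r k X A" "(\<beta>, \<gamma>2) \<in> path_equiv r k X A"
      using C D that \<gamma> quotient_eq_iff[OF equiv_path_equiv] unfolding path_classes_def by blast+
    from path_equiv_endpoints[OF this(1)] path_equiv_endpoints[OF this(2)] show ?thesis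
      using \<gamma>(3) by (simp add: composable_def)
  qed
  have mult: "path_mult \<alpha> \<beta> \<in> \<P>" "\<rho> (path_mult \<alpha> \<beta>) = induced_map \<rho> C \<otimes> induced_map \<rho> D"
    if "\<alpha> \<in> C" "\<beta> \<in> D" for \<alpha> \<beta>
  proof -
    have "\<alpha> \<in> \<P>" "\<beta> \<in> \<P>"
      using that path_classes_subset[OF C] path_classes_subset[OF D] by auto
    with comp[OF that] show "path_mult \<alpha> \<beta> \<in> \<P>"
        "\<rho> (path_mult \<alpha> \<beta>) = induced_map \<rho> C \<otimes> induced_map \<rho> D"
      using path_mult_in_paths germ_path_mult[OF \<rho>]
        induced_map_eq[OF \<rho> C that(1)] induced_map_eq[OF \<rho> D that(2)] by simp_all
  qed
  let ?M = "class_mult r k X A C D" and ?g = "induced_map \<rho> C \<otimes> induced_map \<rho> D"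
  have val: "\<rho> \<delta> = ?g" if "\<delta> \<in> ?M" for \<delta>
    using that mult(2) germ_path_equiv[OF \<rho>] unfolding class_mult_def by fastforce
  have mem: "path_mult \<gamma>1 \<gamma>2 \<in> ?M"
    using \<gamma> equiv_class_self[OF equiv_path_equiv mult(1)[OF \<gamma>(1,2)]] unfolding class_mult_def by blast
  have "\<rho> ` ?M = {?g}"
  proof
    show "\<rho> ` ?M \<subseteq> {?g}" using val by (intro image_subsetI) simp
    show "{?g} \<subseteq> \<rho> ` ?M" using val[OF mem] mem by (metis empty_subsetI image_eqI insert_subset)
  qed
  then show "induced_map \<rho> (class_mult r k X A C D) = induced_map \<rho> C \<otimes> induced_map \<rho> D"
    by (simp add: induced_map_def[of \<rho> "class_mult r k X A C D"])
qed

end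

section \<open>Extension of germs\<close>

locale complete_germ = path_space_group r k X A G
  for r k X and A :: "('m, 'e::real_normed_vector) chart set" and G (structure) +
  fixes Q and \<rho>
  assumes complete: "complete_paths r k X A Q"
    and germ: "germ r k X A G Q \<rho>"
begin

text \<open>
  A relation, because the product along a partition is not yet known to be independent of the
  partition.
\<close>

inductive segment_value for \<gamma> where
  base: "0 \<le> a \<Longrightarrow> a < b \<Longrightarrow> b \<le> 1 \<Longrightarrow> segment \<gamma> a b \<in> Q \<Longrightarrow>
    segment_value \<gamma> a b (\<rho> (segment \<gamma> a b))"
| mult: "segment_value \<gamma> a b g \<Longrightarrow> segment_value \<gamma> b c h \<Longrightarrow> segment_value \<gamma> a c (g \<otimes> h)"

section \<open>Independence of the product from the partition\<close>

lemma segment_value_bounds: "segment_value \<gamma> a b g \<Longrightarrow> 0 \<le> a \<and> a < b \<and> b \<le> 1"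
  by (induction rule: segment_value.induct) auto

lemma segment_value_closed: "segment_value \<gamma> a b g \<Longrightarrow> g \<in> carrier G"
  by (induction rule: segment_value.induct) (auto intro: germD(2)[OF germ])

lemma segment_subdivide:
  assumes "\<gamma> \<in> \<P>" "segment \<gamma> a c \<in> Q" "0 \<le> a" "a < b" "b < c" "c \<le> 1"
  shows "segment \<gamma> a b \<in> Q" "segment \<gamma> b c \<in> Q"
    "\<rho> (segment \<gamma> a c) = \<rho> (segment \<gamma> a b) \<otimes> \<rho> (segment \<gamma> b c)"
  using germD(5,6)[OF germ assms(2) decomposition_segments[OF assms(1,3-6)]] by auto

text \<open>Refinement of a partition by the point c. A segment in Q is cut by heredity and the germ
  law; in a product the cut is made in the factor that contains c, and associativity regroups the
  rest.\<close>

lemma segment_value_split: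
  assumes "segment_value \<gamma> a b g" "\<gamma> \<in> \<P>" "a < c" "c < b"
  obtains g1 g2 where "segment_value \<gamma> a c g1" "segment_value \<gamma> c b g2" "g = g1 \<otimes> g2"
  using assms
proof (induction arbitrary: thesis rule: segment_value.induct)
  case (base a b)
  from segment_subdivide[OF base.prems(2) base.hyps(4,1) base.prems(3,4) base.hyps(3)] show ?case
    using base.hyps base.prems(3,4)
    by (intro base.prems(1)[OF segment_value.base segment_value.base]) simp_all
next
  case (mult a b g e h)
  consider "c < b" | "c = b" | "b < c" by linarith
  then show ?case
  proof cases
    case 1
    then obtain g1 g2 where *: "segment_value \<gamma> a c g1" "segment_value \<gamma> c b g2" "g = g1 \<otimes> g2"
      using mult.IH(1) mult.prems by blast
    have "g \<otimes> h = g1 \<otimes> (g2 \<otimes> h)"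
      using * mult.hyps segment_value_closed by (simp add: m_assoc)
    with *(1) segment_value.mult[OF *(2) mult.hyps(2)] show ?thesis by (rule mult.prems(1))
  next
    case 2
    then show ?thesis using mult.hyps by (intro mult.prems(1)) auto
  next
    case 3
    then obtain h1 h2 where *: "segment_value \<gamma> b c h1" "segment_value \<gamma> c e h2" "h = h1 \<otimes> h2"
      using mult.IH(2) mult.prems by blast
    have "g \<otimes> h = (g \<otimes> h1) \<otimes> h2"
      using * mult.hyps segment_value_closed by (simp add: m_assoc)
    with segment_value.mult[OF mult.hyps(1) *(1)] *(2) show ?thesis by (rule mult.prems(1))
  qed
qed

text \<open>By heredity all intermediate segments lie in Q as well, so the germ law collapses the
  product step by step.\<close>

lemma segment_value_in_Q:
  "segment_value \<gamma> a b g \<Longrightarrow> \<gamma> \<in> \<P> \<Longrightarrow> segment \<gamma> a b \<in> Q \<Longrightarrow> g = \<rho> (segment \<gamma> a b)"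
proof (induction rule: segment_value.induct)
  case (mult a b g c h)
  from segment_value_bounds[OF mult.hyps(1)] segment_value_bounds[OF mult.hyps(2)]
  have "0 \<le> a" "a < b" "b < c" "c \<le> 1" by auto
  from segment_subdivide[OF mult.prems this] show ?case
    using mult.IH mult.prems(1) by simp
qed simp

text \<open>The common refinement in one-sided form: the second value is split along the derivation
  of the first, until the segments lie in Q and \<open>segment_value_in_Q\<close> applies.\<close>

lemma segment_value_unique:
  "segment_value \<gamma> a b g \<Longrightarrow> \<gamma> \<in> \<P> \<Longrightarrow> segment_value \<gamma> a b g' \<Longrightarrow> g' = g"
proof (induction arbitrary: g' rule: segment_value.induct)
  case (base a b)
  then show ?case by (intro segment_value_in_Q) auto
next
  case (mult a b g c h)
  have "a < b" "b < c" using segment_value_bounds mult.hyps by blast+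
  then obtain g1 g2 where "segment_value \<gamma> a b g1" "segment_value \<gamma> b c g2" "g' = g1 \<otimes> g2"
    using segment_value_split[OF mult.prems(2,1)] by metis
  then show ?case using mult.IH mult.prems(1) by metis
qed

text \<open>The partition is moved by \<phi>. Corresponding segments coincide up to the
  parametrization, and \<rho> has the same value on them.\<close>

lemma segment_value_reparametrize:
  assumes "segment_value \<gamma> a b g" "interval_diffeo r \<phi> \<psi> 0 1 0 1"
    "\<And>t. t \<in> {0..1} \<Longrightarrow> \<gamma> t = \<gamma>' (\<phi> t)" "\<gamma>' \<in> \<P>"
  shows "segment_value \<gamma>' (\<phi> a) (\<phi> b) g"
  using assms(1)
proof (induction rule: segment_value.induct)
  case (base a b)
  note diffeo = interval_diffeo_restrict[OF assms(2) base.hyps(1-3)]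
  have bounds: "\<phi> a \<in> {0..1}" "\<phi> b \<in> {0..1}" "\<phi> a < \<phi> b"
    using interval_diffeoD(3)[OF assms(2)] interval_diffeoD(2)[OF diffeo] base.hyps by auto
  have coinc: "coincide r (segment \<gamma> a b) (segment \<gamma>' (\<phi> a) (\<phi> b))"
    using diffeo by (rule coincide_segments) (use base.hyps assms(3) in auto)
  \<comment> \<open>A decomposition with a single member: through it heredity makes Q closed under
    reparametrization.\<close>
  have "decomposition r k X A [segment \<gamma>' (\<phi> a) (\<phi> b)] (segment \<gamma> a b)"
    unfolding decomposition_single
    using segment_in_paths[OF assms(4)] bounds coincide_sym[OF coinc] by auto
  from germD(5)[OF germ base.hyps(4) this] have in_Q: "segment \<gamma>' (\<phi> a) (\<phi> b) \<in> Q" by simp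
  then show ?case
    unfolding germ_coincide[OF germ base.hyps(4) in_Q coinc]
    using bounds by (intro segment_value.base) auto
qed (rule segment_value.mult)

lemma segment_value_coincide:
  assumes "segment_value \<gamma> 0 1 g" "coincide r \<gamma> \<gamma>'" "\<gamma>' \<in> \<P>"
  shows "segment_value \<gamma>' 0 1 g"
proof -
  obtain \<phi> \<psi> where diffeo: "interval_diffeo r \<phi> \<psi> 0 1 0 1"
    and "\<And>t. t \<in> {0..1} \<Longrightarrow> \<gamma> t = \<gamma>' (\<phi> t)"
    using assms(2) unfolding coincide_iff by blast
  from segment_value_reparametrize[OF assms(1) this assms(3)] show ?thesis
    using interval_diffeo_endpoints[OF diffeo] by simp
qed

section \<open>Products, inverses and existence of the value\<close>

lemma segment_value_path_mult:
  assumes "segment_value \<gamma>1 0 1 g" "segment_value \<gamma>2 0 1 h" "composable \<gamma>1 \<gamma>2"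
  shows "segment_value (path_mult \<gamma>1 \<gamma>2) 0 1 (g \<otimes> h)"
proof -
  \<comment> \<open>The segments of a factor are equal, as maps, to segments of the product at half
    the scale, so the same values of \<rho> occur.\<close>
  have "segment_value (path_mult \<gamma>1 \<gamma>2) (a / 2) (b / 2) x" if "segment_value \<gamma>1 a b x" for a b x
    using that
  proof (induction rule: segment_value.induct)
    case (base a b)
    then show ?case
      using segment_path_mult_left[of a b \<gamma>1 \<gamma>2] segment_value.base[of "a / 2" "b / 2" "path_mult \<gamma>1 \<gamma>2"]
      by simp
  qed (rule segment_value.mult)
  from this[OF assms(1)] have left: "segment_value (path_mult \<gamma>1 \<gamma>2) 0 (1 / 2) g" by simp
  have "segment_value (path_mult \<gamma>1 \<gamma>2) ((1 + a) / 2) ((1 + b) / 2) x"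
    if "segment_value \<gamma>2 a b x" for a b x
    using that
  proof (induction rule: segment_value.induct)
    case (base a b)
    then show ?case
      using segment_path_mult_right[OF assms(3), of a b]
        segment_value.base[of "(1 + a) / 2" "(1 + b) / 2" "path_mult \<gamma>1 \<gamma>2"]
      by simp
  qed (rule segment_value.mult)
  from this[OF assms(2)] have right: "segment_value (path_mult \<gamma>1 \<gamma>2) (1 / 2) 1 h" by simp
  from left right show ?thesis by (rule segment_value.mult)
qed

lemma segment_value_path_inv:
  "segment_value \<gamma> a b g \<Longrightarrow> segment_value (path_inv \<gamma>) (1 - b) (1 - a) (inv g)"
proof (induction rule: segment_value.induct)
  case (base a b)
  have "segment (path_inv \<gamma>) (1 - b) (1 - a) = path_inv (segment \<gamma> a b)"
    using base.hyps by (simp add: segment_path_inv path_inv_segment)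
  then show ?case
    using germD(3,4)[OF germ base.hyps(4)] base.hyps
      segment_value.base[of "1 - b" "1 - a" "path_inv \<gamma>"] by simp
next
  case (mult a b g c h)
  then show ?case
    \<comment> \<open>Running backwards reverses the order of the pieces, as the inverse of a
      product reverses its factors.\<close>
    using segment_value.mult[OF mult.IH(2,1)] segment_value_closed by (simp add: inv_mult_group)
qed

lemma segment_value_member:
  assumes "\<gamma> \<in> Q"
  shows "segment_value \<gamma> 0 1 (\<rho> \<gamma>)"
  using segment_value.base[of 0 1 \<gamma>] assms segment_0_1[OF paths_extensional[OF germD(1)[OF germ assms]]]
  by simp

lemma segment_value_path_prod:
  "\<gamma>s \<noteq> [] \<Longrightarrow> set \<gamma>s \<subseteq> Q \<Longrightarrow> successively composable \<gamma>s \<Longrightarrow>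
     \<exists>g. segment_value (path_prod \<gamma>s) 0 1 g"
proof (induction \<gamma>s)
  case (Cons \<gamma> \<gamma>s)
  have \<gamma>: "segment_value \<gamma> 0 1 (\<rho> \<gamma>)"
    using Cons.prems(2) by (intro segment_value_member) simp
  show ?case
  proof (cases "\<gamma>s = []")
    case False
    then obtain g where "segment_value (path_prod \<gamma>s) 0 1 g"
      using Cons by (auto simp: successively_Cons)
    from segment_value_path_mult[OF \<gamma> this composable_path_prod[OF Cons.prems(3) False]] show ?thesis
      unfolding path_prod_Cons[OF False] by blast
  qed (use \<gamma> in auto)
qed simp

lemma segment_value_exists:
  assumes "\<gamma> \<in> \<P>"
  obtains g where "segment_value \<gamma> 0 1 g"
proof -
  obtain \<gamma>s where "decomposition r k X A \<gamma>s \<gamma>" "set \<gamma>s \<subseteq> Q"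
    using complete assms unfolding complete_paths_def by blast
  then have "\<exists>g. segment_value (path_prod \<gamma>s) 0 1 g" "coincide r (path_prod \<gamma>s) \<gamma>"
    by (auto simp: decomposition_def intro!: segment_value_path_prod)
  then show ?thesis
    using segment_value_coincide assms that by blast
qed

text \<open>The restriction to \<open>\<P>\<close> makes the function extensional, as uniqueness
  among functions on the whole type requires.\<close>

definition extension where
  "extension = (\<lambda>\<gamma>\<in>\<P>. THE g. segment_value \<gamma> 0 1 g)"

lemma extension_eq:
  assumes "\<gamma> \<in> \<P>" "segment_value \<gamma> 0 1 g"
  shows "extension \<gamma> = g"
proof -
  have "(THE g. segment_value \<gamma> 0 1 g) = g"
    using assms(2) segment_value_unique[OF assms(2,1)] by (rule the_equality)
  then show ?thesis using assms(1) by (simp add: extension_def)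
qed

text \<open>For multiplicativity no partition of \<gamma> is chosen: those of \<gamma>1 and
  \<gamma>2 are put together and transported to \<gamma>, and uniqueness of the value identifies the
  result.\<close>

lemma germ_extension: "germ r k X A G \<P> extension"
  unfolding germ_def
proof (intro conjI ballI allI impI hereditary_paths)
  show "extension \<in> \<P> \<rightarrow> carrier G"
  proof
    fix \<gamma> assume \<gamma>: "\<gamma> \<in> \<P>"
    then obtain g where g: "segment_value \<gamma> 0 1 g" by (rule segment_value_exists)
    then show "extension \<gamma> \<in> carrier G"
      using segment_value_closed by (simp add: extension_eq[OF \<gamma> g])
  qed
next
  fix \<gamma> assume \<gamma>: "\<gamma> \<in> \<P>"
  then obtain g where g: "segment_value \<gamma> 0 1 g" by (rule segment_value_exists)
  show "extension (path_inv \<gamma>) = inv (extension \<gamma>)"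
    unfolding extension_eq[OF \<gamma> g]
    using segment_value_path_inv[OF g] by (intro extension_eq path_inv_in_paths \<gamma>) simp
next
  fix \<gamma> \<gamma>1 \<gamma>2 assume \<gamma>: "\<gamma> \<in> \<P>" and "decomposition r k X A [\<gamma>1, \<gamma>2] \<gamma>"
  then have *: "\<gamma>1 \<in> \<P>" "\<gamma>2 \<in> \<P>" "composable \<gamma>1 \<gamma>2" "coincide r (path_mult \<gamma>1 \<gamma>2) \<gamma>"
    by (auto simp: decomposition_pair)
  obtain g where g: "segment_value \<gamma>1 0 1 g" using *(1) by (rule segment_value_exists)
  obtain h where h: "segment_value \<gamma>2 0 1 h" using *(2) by (rule segment_value_exists)
  show "extension \<gamma> = extension \<gamma>1 \<otimes> extension \<gamma>2"
    unfolding extension_eq[OF *(1) g] extension_eq[OF *(2) h]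
    by (intro extension_eq[OF \<gamma>] segment_value_coincide[OF _ *(4) \<gamma>]
        segment_value_path_mult[OF g h *(3)])
qed

lemma extension_member: "\<gamma> \<in> Q \<Longrightarrow> extension \<gamma> = \<rho> \<gamma>"
  using germD(1)[OF germ] segment_value_member by (intro extension_eq)

section \<open>Product formula and uniqueness of the extension\<close>

lemma germ_extending_eq:
  assumes \<rho>': "germ r k X A G \<P> \<rho>'" "\<And>\<gamma>. \<gamma> \<in> Q \<Longrightarrow> \<rho>' \<gamma> = \<rho> \<gamma>"
    and "\<gamma> \<in> \<P>" "decomposition r k X A \<gamma>s \<gamma>" "set \<gamma>s \<subseteq> Q"
  shows "\<rho>' \<gamma> = foldr (\<otimes>) (map \<rho> \<gamma>s) \<one>"
proof -
  have eq: "map \<rho>' \<gamma>s = map \<rho> \<gamma>s" using assms(2,5) by (intro map_cong) auto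
  show ?thesis using germ_decomposition[OF \<rho>'(1) assms(3,4)] unfolding eq .
qed

lemma germ_extending_unique:
  assumes "germ r k X A G \<P> \<rho>1" "\<And>\<gamma>. \<gamma> \<in> Q \<Longrightarrow> \<rho>1 \<gamma> = \<rho> \<gamma>"
    and "germ r k X A G \<P> \<rho>2" "\<And>\<gamma>. \<gamma> \<in> Q \<Longrightarrow> \<rho>2 \<gamma> = \<rho> \<gamma>" and "\<gamma> \<in> \<P>"
  shows "\<rho>1 \<gamma> = \<rho>2 \<gamma>"
proof -
  obtain \<gamma>s where \<gamma>s: "decomposition r k X A \<gamma>s \<gamma>" "set \<gamma>s \<subseteq> Q"
    using complete \<open>\<gamma> \<in> \<P>\<close> unfolding complete_paths_def by blast
  show ?thesis
    using germ_extending_eq[OF assms(1,2,5) \<gamma>s] germ_extending_eq[OF assms(3,4,5) \<gamma>s] by simp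
qed

lemma ex1_extension:
  "\<exists>!\<rho>'. \<rho>' \<in> extensional \<P> \<and> germ r k X A G \<P> \<rho>' \<and> (\<forall>\<gamma>\<in>Q. \<rho>' \<gamma> = \<rho> \<gamma>)"
proof (rule ex1I[of _ extension])
  show "extension \<in> extensional \<P> \<and> germ r k X A G \<P> extension \<and> (\<forall>\<gamma>\<in>Q. extension \<gamma> = \<rho> \<gamma>)"
    using germ_extension extension_member by (simp add: extension_def)
  then show "\<rho>' = extension"
    if "\<rho>' \<in> extensional \<P> \<and> germ r k X A G \<P> \<rho>' \<and> (\<forall>\<gamma>\<in>Q. \<rho>' \<gamma> = \<rho> \<gamma>)" for \<rho>'
    using that germ_extending_unique[of \<rho>' extension] by (intro extensionalityI[of _ \<P>]) auto
qed

end

theorem proposition3p1: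
  fixes r :: regularity
    and k :: path_kind
    and X :: "'m topology"
    and A :: "('m, 'e::real_normed_vector) chart set"
    and G :: "('g, 'z) monoid_scheme"
    and T :: "'g topology"
    and B :: "('g, 'f::real_normed_vector) chart set"
    and Q :: "(real \<Rightarrow> 'm) set"
    and \<rho> :: "(real \<Rightarrow> 'm) \<Rightarrow> 'g"
  assumes "r \<noteq> C_fin 0"
    and "manifold r X A"
    and "lie_group G T B" and "connected_space T"
    and "complete_paths r k X A Q"
    and "germ r k X A G Q \<rho>"
  shows "(\<exists>!\<rho>'. \<rho>' \<in> extensional (paths r k X A) \<and>
             germ r k X A G (paths r k X A) \<rho>' \<and> (\<forall>\<gamma>\<in>Q. \<rho>' \<gamma> = \<rho> \<gamma>)) \<and>
         (\<forall>\<rho>'. germ r k X A G (paths r k X A) \<rho>' \<and> (\<forall>\<gamma>\<in>Q. \<rho>' \<gamma> = \<rho> \<gamma>) \<longrightarrow>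
           (\<forall>\<gamma>\<in>paths r k X A. \<forall>\<gamma>s. decomposition r k X A \<gamma>s \<gamma> \<and> set \<gamma>s \<subseteq> Q \<longrightarrow>
              \<rho>' \<gamma> = foldr (\<otimes>\<^bsub>G\<^esub>) (map \<rho> \<gamma>s) \<one>\<^bsub>G\<^esub>) \<and>
           (\<forall>\<gamma> \<gamma>'. (\<gamma>, \<gamma>') \<in> path_equiv r k X A \<longrightarrow> \<rho>' \<gamma> = \<rho>' \<gamma>') \<and>
           groupoid_hom r k X A G (induced_map \<rho>'))"
proof -
  have "group G" using assms(3) by (simp add: lie_group_def)
  then interpret complete_germ r k X A G Q \<rho>
    using assms(1,5,6)
    by (simp add: complete_germ_def complete_germ_axioms_def path_space_group_def path_space_def)
  show ?thesis
    by (intro conjI ex1_extension allI impI ballI; elim conjE)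
      (simp_all add: germ_extending_eq germ_path_equiv groupoid_hom_induced_map)
qed

end
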